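(* Let $m\ge 1$, $a\ge 1$ and $d\ge 3$ be integers, and let $D_1,\dots,D_m$ be integers with $D_i\ge d$ for all $1\le i\le m$; put $n=D_1+\cdots+D_m$ and assume $a\ne m-1$. Consider a deck of $n$ cards consisting of $D_1$ $1$'s on top, followed by $D_2$ $2$'s, and so on, ending with $D_m$ $m$'s at the bottom. Then the separation distance after an $a$-shuffle of this deck is $$1-(1+\eta)\,\frac{a^{m-1}}{(n+1)\cdots(n+m-1)}\sum_{j=0}^{m-1}(-1)^j\binom{m-1}{j}\Big(1-\frac{j}{a}\Big)^{n+m-1},$$ where $\eta$ is a real number satisfying $$|\eta|\le\Big(1+\frac{n^2}{3(d-2)(a-m+1)^2}\Big)^{m-1}-1 .$$
   Context: $a$-shuffle of $n$ cards: the deck is cut into $a$ consecutive packets of sizes $A_1,\dots,A_a\ge 0$ (packet $1$ on top, empty packets allowed), $A_1+\cdots+A_a=n$, with probability $a^{-n}\binom{n}{A_1,\dots,A_a}$; the packets are then riffled together by dropping cards one at a time from the bottoms of the packets, the next card coming from a given packet with probability proportional to its current size (equivalently, all interleavings preserving the order within each packet are equally likely). Cards of the same type are indistinguishable, so a deck configuration is a word $w$ containing $D_i$ letters $i$ for each $i$. If $Q_a(w)$ is the probability that the $a$-shuffle results in configuration $w$, the separation distance is $\max_w\big(1-Q_a(w)/U\big)$, where $U=D_1!\cdots D_m!/n!$ is the uniform probability and the maximum is over all configurations. The empty product $(n+1)\cdots(n+m-1)$ for $m=1$ equals $1$. *)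

theory Defs
  imports "HOL-Probability.Probability"
begin

text \<open>A deck is a list of cards, read from top to bottom: its head is the top card.\<close>

definition cut_sizes :: "nat \<Rightarrow> nat \<Rightarrow> nat list set" where
  "cut_sizes a n = {A. length A = a \<and> sum_list A = n}"

definition cut_prob :: "nat \<Rightarrow> nat \<Rightarrow> nat list \<Rightarrow> real" where
  "cut_prob a n A =
     (if A \<in> cut_sizes a n then fact n / (\<Prod>k\<leftarrow>A. fact k) / real a ^ n else 0)"

text \<open>This is a probability distribution only for \<open>a \<ge> 1\<close>, see \<open>pmf_cut_pmf\<close> below.\<close>

definition cut_pmf :: "nat \<Rightarrow> nat \<Rightarrow> nat list pmf" where
  "cut_pmf a n = embed_pmf (cut_prob a n)"

fun packets :: "nat list \<Rightarrow> 'a list \<Rightarrow> 'a list list" where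
  "packets [] xs = []"
| "packets (k # A) xs = take k xs # packets A (drop k xs)"

definition num_cards :: "'a list list \<Rightarrow> nat" where
  "num_cards Ps = (\<Sum>P\<leftarrow>Ps. length P)"

text \<open>The index of the packet from which the next card drops.
  It is meaningful only if \<open>num_cards Ps > 0\<close>, see \<open>pmf_drop_pmf\<close> below.\<close>

definition drop_pmf :: "'a list list \<Rightarrow> nat pmf" where
  "drop_pmf Ps =
     pmf_of_list (map (\<lambda>i. (i, real (length (Ps ! i)) / real (num_cards Ps))) [0..<length Ps])"

text \<open>Drop \<open>k\<close> cards, one at a time, each from the bottom of its packet. The pile grows
  upwards, so the card dropped first ends up below all cards dropped after it.\<close>

primrec riffle :: "nat \<Rightarrow> 'a list list \<Rightarrow> 'a list pmf" where
  "riffle 0 Ps = return_pmf []"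
| "riffle (Suc k) Ps =
     bind_pmf (drop_pmf Ps)
       (\<lambda>i. map_pmf (\<lambda>ys. ys @ [last (Ps ! i)]) (riffle k (Ps[i := butlast (Ps ! i)])))"

definition shuffle_pmf :: "nat \<Rightarrow> 'a list \<Rightarrow> 'a list pmf" where
  "shuffle_pmf a xs =
     bind_pmf (cut_pmf a (length xs)) (\<lambda>A. riffle (length xs) (packets A xs))"

definition deck :: "nat \<Rightarrow> (nat \<Rightarrow> nat) \<Rightarrow> nat list" where
  "deck m D = concat (map (\<lambda>i. replicate (D i) i) [1..<m + 1])"

definition configurations :: "nat \<Rightarrow> (nat \<Rightarrow> nat) \<Rightarrow> nat list set" where
  "configurations m D =
     {w. set w \<subseteq> {1..m} \<and> (\<forall>i\<in>{1..m}. count_list w i = D i)}"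

definition uniform_prob :: "nat \<Rightarrow> (nat \<Rightarrow> nat) \<Rightarrow> real" where
  "uniform_prob m D = (\<Prod>i=1..m. fact (D i)) / fact (\<Sum>i=1..m. D i)"

definition separation_distance :: "nat \<Rightarrow> nat \<Rightarrow> (nat \<Rightarrow> nat) \<Rightarrow> real" where
  "separation_distance a m D =
     Max ((\<lambda>w. 1 - pmf (shuffle_pmf a (deck m D)) w / uniform_prob m D) ` configurations m D)"

text \<open>The definitions by \<open>embed_pmf\<close>, \<open>pmf_of_list\<close> and \<open>Max\<close> have their intended meaning.\<close>

lemma finite_cut_sizes: "finite (cut_sizes a n)"
proof (rule finite_subset)
  show "cut_sizes a n \<subseteq> {A. set A \<subseteq> {..n} \<and> length A = a}"
    unfolding cut_sizes_def by (auto intro: member_le_sum_list)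
qed (simp add: finite_lists_length_eq)

lemma cut_sizes_Suc: "cut_sizes (Suc a) n = (\<Union>k\<in>{..n}. (#) k ` cut_sizes a (n - k))"
  (is "?L = ?R")
proof
  show "?L \<subseteq> ?R"
  proof
    fix A assume "A \<in> ?L"
    then obtain k B where "A = k # B" "length B = a" "k + sum_list B = n"
      unfolding cut_sizes_def by (cases A) auto
    then show "A \<in> ?R" unfolding cut_sizes_def by force
  qed
qed (auto simp: cut_sizes_def)

lemma sum_multinomial:
  "(\<Sum>A\<in>cut_sizes a n. fact n / (\<Prod>k\<leftarrow>A. fact k)) = real a ^ n"
proof (induction a arbitrary: n)
  case 0
  have "cut_sizes 0 n = (if n = 0 then {[]} else {})"
    by (auto simp: cut_sizes_def)
  then show ?case by simp
next
  case (Suc a)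
  have "(\<Sum>A\<in>cut_sizes (Suc a) n. fact n / (\<Prod>k\<leftarrow>A. fact k) :: real)
      = (\<Sum>k\<le>n. \<Sum>A\<in>(#) k ` cut_sizes a (n - k). fact n / (\<Prod>k\<leftarrow>A. fact k))"
    unfolding cut_sizes_Suc
    by (rule sum.UNION_disjoint) (auto simp: finite_cut_sizes)
  also have "\<dots> = (\<Sum>k\<le>n. real (n choose k) * real a ^ (n - k))"
  proof (rule sum.cong[OF refl])
    fix k assume k: "k \<in> {..n}"
    have "(\<Sum>A\<in>(#) k ` cut_sizes a (n - k). fact n / (\<Prod>k\<leftarrow>A. fact k) :: real)
        = (\<Sum>A\<in>cut_sizes a (n - k). fact n / (fact k * (\<Prod>k\<leftarrow>A. fact k)))"
      by (subst sum.reindex) (auto simp: inj_on_def)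
    also have "\<dots> = (\<Sum>A\<in>cut_sizes a (n - k).
        real (n choose k) * (fact (n - k) / (\<Prod>k\<leftarrow>A. fact k)))"
      using k by (intro sum.cong refl) (simp add: binomial_fact field_simps)
    also have "\<dots> = real (n choose k) * real a ^ (n - k)"
      by (simp only: sum_distrib_left[symmetric] Suc.IH)
    finally show "(\<Sum>A\<in>(#) k ` cut_sizes a (n - k). fact n / (\<Prod>k\<leftarrow>A. fact k) :: real)
        = real (n choose k) * real a ^ (n - k)" .
  qed
  also have "\<dots> = real (Suc a) ^ n"
    using binomial_ring[of "1::real" "real a" n] by simp
  finally show ?case .
qed

lemma cut_prob_nonneg: "cut_prob a n A \<ge> 0"
proof -
  have "(\<Prod>k\<leftarrow>A. fact k :: real) \<ge> 0" by (induction A) auto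
  then show ?thesis unfolding cut_prob_def by simp
qed

lemma pmf_cut_pmf:
  assumes "a \<ge> 1"
  shows "pmf (cut_pmf a n) A = cut_prob a n A"
  unfolding cut_pmf_def
proof (rule pmf_embed_pmf)
  have "(\<integral>\<^sup>+A. ennreal (cut_prob a n A) \<partial>count_space UNIV)
      = (\<Sum>A\<in>cut_sizes a n. ennreal (cut_prob a n A))"
    by (rule nn_integral_count_space'[OF finite_cut_sizes])
       (auto simp: cut_prob_def)
  also have "\<dots> = ennreal (\<Sum>A\<in>cut_sizes a n. cut_prob a n A)"
    by (rule sum_ennreal) (rule cut_prob_nonneg)
  also have "(\<Sum>A\<in>cut_sizes a n. cut_prob a n A)
      = (\<Sum>A\<in>cut_sizes a n. fact n / (\<Prod>k\<leftarrow>A. fact k)) / real a ^ n"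
    unfolding sum_divide_distrib by (rule sum.cong) (auto simp: cut_prob_def)
  also have "\<dots> = 1"
    using assms by (simp add: sum_multinomial)
  finally show "(\<integral>\<^sup>+A. ennreal (cut_prob a n A) \<partial>count_space UNIV) = 1" by simp
qed (rule cut_prob_nonneg)

lemma drop_pmf_wf:
  assumes "num_cards Ps > 0"
  shows "pmf_of_list_wf
    (map (\<lambda>i. (i, real (length (Ps ! i)) / real (num_cards Ps))) [0..<length Ps])"
proof (rule pmf_of_list_wfI)
  have "real (num_cards Ps) = (\<Sum>i<length Ps. real (length (Ps ! i)))"
    unfolding num_cards_def by (simp add: sum_list_sum_nth atLeast0LessThan)
  then show "sum_list (map snd
      (map (\<lambda>i. (i, real (length (Ps ! i)) / real (num_cards Ps))) [0..<length Ps])) = 1"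
    using assms
    by (simp add: o_def interv_sum_list_conv_sum_set_nat atLeast0LessThan
        flip: sum_divide_distrib)
qed auto

lemma pmf_drop_pmf:
  assumes "num_cards Ps > 0" "i < length Ps"
  shows "pmf (drop_pmf Ps) i = real (length (Ps ! i)) / real (num_cards Ps)"
proof -
  have "filter (\<lambda>j. j = i) [0..<k] = (if i < k then [i] else [])" for k
    by (induction k) auto
  with assms(2) have "filter (\<lambda>j. j = i) [0..<length Ps] = [i]" by simp
  then show ?thesis
    unfolding drop_pmf_def
    by (subst pmf_pmf_of_list[OF drop_pmf_wf[OF assms(1)]]) (simp add: filter_map o_def)
qed

lemma finite_configurations: "finite (configurations m D)"
proof (rule finite_subset)
  show "configurations m D \<subseteq> {w. set w \<subseteq> {1..m} \<and> length w = (\<Sum>i=1..m. D i)}"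
  proof safe
    fix w assume w: "w \<in> configurations m D"
    then have "set w \<subseteq> {1..m}" by (auto simp: configurations_def)
    then have "length w = (\<Sum>i=1..m. count_list w i)"
      by (simp add: sum_count_set)
    then show "length w = (\<Sum>i=1..m. D i)"
      using w by (auto simp: configurations_def)
  qed (auto simp: configurations_def)
qed (simp add: finite_lists_length_eq)

lemma deck_in_configurations: "deck m D \<in> configurations m D"
proof -
  have rep: "count_list (replicate n j) i = (if j = i then n else 0)" for n j i :: nat
    by (induction n) auto
  have "count_list (deck m D) i = D i" if "i \<in> {1..m}" for i
    using that unfolding deck_def
    by (induction m) (auto simp: rep count_list_0_iff le_Suc_eq)
  then show ?thesis
    by (auto simp: configurations_def deck_def)
qed

end

theory Submission
  imports Defs
begin

text \<open>
  Why the theorem holds. Label every position of the shuffled deck with the packet its card came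
  from. All \<open>a ^ n\<close> labellings are equally likely, and a configuration \<open>w\<close> arises from those
  labellings for which reading off the cards packet by packet recovers the original deck
  (\<open>pmf_shuffle\<close>). Since the original deck is sorted, a labelling that gives every card of a smaller
  type a strictly smaller label than every card of a larger type always qualifies, whatever \<open>w\<close> is.
  For the reversed deck no other labelling does. The number of these strict labellings does not
  depend on the order of the cards, so the reversed deck is the least likely configuration, and the
  separation distance is determined by the number of strict labellings
  (\<open>separation_distance_eq\<close>).

  Peeling off the last type according to its smallest label gives a recurrence for this number: with
  \<open>r = D (k + 1)\<close>, the number for \<open>k + 1\<close> types and \<open>a\<close> labels is
  \<open>\<Sum>b=1..a. (b ^ r - (b - 1) ^ r) * N k (a - b)\<close>, where \<open>N k\<close> is the number for \<open>k\<close> types. After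
  division by factorials this is an iterated convolution sum of truncated powers
  \<open>\<phi> q x = (max 0 x) ^ q / q!\<close> and their increments \<open>\<phi> r b - \<phi> r (b - 1)\<close>. If the sums were
  integrals, the Beta integral \<open>\<integral>\<phi> p (x - t) * \<phi> q (A - x) dx = \<phi> (p + q + 1) (A - t)\<close> would
  evaluate them exactly: every step would replace \<open>\<phi>\<close> by a backward difference of a higher \<open>\<phi>\<close>, and
  the result, the backward difference of order \<open>m - 1\<close> of \<open>\<phi> (n + m - 1)\<close> at \<open>a\<close>, is the alternating
  sum in the theorem (\<open>main_term_eq_bdiff\<close>).

  It remains to compare sum and integral. For \<open>g x = \<phi> p (x - t) * \<phi> q (A - x)\<close>, which vanishes
  together with \<open>g'\<close> at the ends of its support, the trapezoidal rule gives
  \<open>\<Sum>g - \<integral>g = \<integral>g'' K\<close> with a kernel \<open>0 \<le> K \<le> 1 / 8\<close>. With \<open>u = x - t\<close> and \<open>v = A - x\<close>,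
  \<open>g'' = g * (p / u - q / v)\<^sup>2 - g * (p / u\<^sup>2 + q / v\<^sup>2)\<close> is a difference of two
  nonnegative functions. Their integrals agree, since \<open>g''\<close> integrates to \<open>0\<close>, and Beta integrals
  evaluate the second one. Hence the error is at most
  \<open>(1 / (p - 1) + 1 / (q - 1)) / 8 * \<phi> (p + q - 1) (A - t)\<close> (\<open>sum_tpow_tpow\<close>); this is where the
  factor \<open>1 / (d - 2)\<close> comes from. Integrating over shifts of \<open>t\<close> and \<open>A\<close> turns the estimate into one
  for backward differences (\<open>sum_increment_bdiff_tpow\<close>).

  The error is again a multiple of a backward difference of some \<open>\<phi>\<close>, with exponent lowered by
  \<open>2\<close>, so the estimate can be iterated, and the errors accumulate like a binomial expansion
  (\<open>iterated_sum_error\<close>). Lowering the exponent by \<open>2\<close> multiplies the value at \<open>a\<close> by at most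
  \<open>(n / (a - m + 1))\<^sup>2\<close> (\<open>bdiff_tpow_ratio\<close>), which turns the expansion into
  \<open>(1 + n\<^sup>2 / (4 * (d - 2) * (a - m + 1)\<^sup>2)) ^ (m - 1) - 1\<close> for the relative error.

  When \<open>a < m - 1\<close>, there are too few labels for a strict labelling, the separation distance is \<open>1\<close>,
  and \<open>\<eta> = -1\<close> is allowed because the bound is then at least \<open>1\<close>.
\<close>

section \<open>Counting the labellings that lead to a configuration\<close>

definition subword :: "nat \<Rightarrow> nat list \<Rightarrow> 'a list \<Rightarrow> 'a list" where
  "subword i l w = map snd (filter (\<lambda>p. fst p = i) (zip l w))"

text \<open>
  The labellings that record from which packet of \<open>Ps\<close> each card of \<open>w\<close> came, when \<open>w\<close> results from
  riffling the packets together. Riffling keeps the order within each packet, so the cards labelled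
  \<open>i\<close> must spell out packet \<open>i\<close>. Distinct interleavings of packets that share card types may give the
  same \<open>w\<close>; each of them contributes its own labelling.
\<close>

definition origins :: "'a list list \<Rightarrow> 'a list \<Rightarrow> nat list set" where
  "origins Ps w = {l. length l = length w \<and> set l \<subseteq> {..<length Ps} \<and>
     (\<forall>i<length Ps. subword i l w = Ps ! i)}"

text \<open>
  The labellings of \<open>w\<close> that arise from an \<open>a\<close>-shuffle of \<open>xs\<close> with any cut: the packet sizes are the
  numbers of positions with each label. Equivalently, sorting the cards of \<open>w\<close> stably by their labels,
  which is the inverse shuffle, gives back \<open>xs\<close>.
\<close>

definition sorting_labels :: "nat \<Rightarrow> 'a list \<Rightarrow> 'a list \<Rightarrow> nat list set" where
  "sorting_labels a xs w = {l. length l = length w \<and> set l \<subseteq> {..<a} \<and>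
     concat (map (\<lambda>i. subword i l w) [0..<a]) = xs}"

lemma finite_origins: "finite (origins Ps w)"
  by (rule finite_subset[of _ "{l. set l \<subseteq> {..<length Ps} \<and> length l = length w}"])
     (auto simp: origins_def finite_lists_length_eq)

lemma subword_snoc:
  "length l = length w \<Longrightarrow>
   subword i (l @ [j]) (w @ [c]) = (if i = j then subword i l w @ [c] else subword i l w)"
  by (simp add: subword_def)

lemma set_drop_pmf: "num_cards Ps > 0 \<Longrightarrow> set_pmf (drop_pmf Ps) \<subseteq> {..<length Ps}"
  using set_pmf_of_list[OF drop_pmf_wf[of Ps]] by (auto simp: drop_pmf_def o_def)

lemma num_cards_eq_sum: "num_cards Ps = (\<Sum>i<length Ps. length (Ps ! i))"
  by (simp add: num_cards_def sum_list_sum_nth atLeast0LessThan)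

text \<open>
  The bottom card \<open>c\<close> of the pile is the one dropped first, so the last label can be any packet
  with \<open>c\<close> at its bottom. This mirrors the recursion of \<open>riffle\<close>.
\<close>

lemma origins_snoc:
  "origins Ps (v @ [c]) = (\<Union>i\<in>{i. i < length Ps \<and> Ps ! i \<noteq> [] \<and> last (Ps ! i) = c}.
      (\<lambda>l. l @ [i]) ` origins (Ps[i := butlast (Ps ! i)]) v)"
proof (intro equalityI subsetI)
  fix l assume l: "l \<in> origins Ps (v @ [c])"
  then obtain l' i where li: "l = l' @ [i]" "length l' = length v"
    by (cases l rule: rev_cases) (auto simp: origins_def)
  have i: "i < length Ps" "set l' \<subseteq> {..<length Ps}" using l li by (auto simp: origins_def)
  have sub: "Ps ! j = (if j = i then subword j l' v @ [c] else subword j l' v)" if "j < length Ps" for j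
    using l li that by (auto simp: origins_def subword_snoc)
  have "l' \<in> origins (Ps[i := butlast (Ps ! i)]) v"
    using i sub li by (auto simp: origins_def nth_list_update)
  then show "l \<in> (\<Union>i\<in>{i. i < length Ps \<and> Ps ! i \<noteq> [] \<and> last (Ps ! i) = c}.
      (\<lambda>l. l @ [i]) ` origins (Ps[i := butlast (Ps ! i)]) v)"
    using i sub[of i] li by auto
next
  fix l assume "l \<in> (\<Union>i\<in>{i. i < length Ps \<and> Ps ! i \<noteq> [] \<and> last (Ps ! i) = c}.
      (\<lambda>l. l @ [i]) ` origins (Ps[i := butlast (Ps ! i)]) v)"
  then obtain i l' where i: "i < length Ps" "Ps ! i \<noteq> []" "last (Ps ! i) = c"
    and l': "l' \<in> origins (Ps[i := butlast (Ps ! i)]) v" and l: "l = l' @ [i]" by blast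
  have "subword j (l' @ [i]) (v @ [c]) = Ps ! j" if "j < length Ps" for j
  proof -
    have "subword j l' v = (if j = i then butlast (Ps ! i) else Ps ! j)"
      using l' that by (auto simp: origins_def nth_list_update)
    then show ?thesis using i l' by (auto simp: origins_def subword_snoc)
  qed
  then show "l \<in> origins Ps (v @ [c])" using i l' l by (auto simp: origins_def)
qed

text \<open>
  All interleavings are equally likely: a sequence of drops has probability
  \<open>(\<Prod>i. fact (length (Ps ! i))) / fact k\<close>, because the numerators of the successive dropping
  probabilities run through \<open>1, \<dots>, length (Ps ! i)\<close> for each packet \<open>i\<close>, and the denominators
  through \<open>1, \<dots>, k\<close>.
\<close>

lemma pmf_riffle:
  assumes "num_cards Ps = k" "length w = k"
  shows "pmf (riffle k Ps) w
    = real (card (origins Ps w)) * (\<Prod>i<length Ps. fact (length (Ps ! i))) / fact k"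
  using assms
proof (induction k arbitrary: Ps w)
  case 0
  then have "Ps ! i = []" if "i < length Ps" for i
    using that by (auto simp: num_cards_eq_sum)
  moreover from this 0 have "origins Ps w = {[]}"
    by (auto simp: origins_def subword_def)
  ultimately show ?case using 0 by simp
next
  case (Suc k)
  obtain v c where w: "w = v @ [c]" "length v = k"
    using Suc.prems by (cases w rule: rev_cases) auto
  define I where "I = {i. i < length Ps \<and> Ps ! i \<noteq> [] \<and> last (Ps ! i) = c}"
  let ?P = "\<Prod>i<length Ps. fact (length (Ps ! i)) :: real"
  have fI: "finite I" by (auto simp: I_def)
  have pos: "num_cards Ps > 0" using Suc.prems by simp
  have snoc: "pmf (map_pmf (\<lambda>ys. ys @ [x]) M) w = (if x = c then pmf M v else 0)" for x M
  proof (cases "x = c")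
    case True
    have "inj (\<lambda>ys. ys @ [x])" by (auto simp: inj_def)
    then show ?thesis using True pmf_map_inj'[of "\<lambda>ys. ys @ [x]" M v] w by simp
  next
    case False
    then show ?thesis using w by (auto simp: pmf_eq_0_set_pmf)
  qed
  have term_eq: "pmf (riffle k (Ps[i := butlast (Ps ! i)])) v * pmf (drop_pmf Ps) i
      = real (card (origins (Ps[i := butlast (Ps ! i)]) v)) * ?P / fact (Suc k)" if "i \<in> I" for i
  proof -
    let ?Q = "Ps[i := butlast (Ps ! i)]"
    have i: "i < length Ps" "Ps ! i \<noteq> []" using that by (auto simp: I_def)
    have split: "(\<Sum>j<length Ps. f j) = f i + (\<Sum>j\<in>{..<length Ps} - {i}. f j)" for f :: "nat \<Rightarrow> nat"
      using i by (subst sum.remove[of _ i]) auto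
    have split': "(\<Prod>j<length Ps. f j) = f i * (\<Prod>j\<in>{..<length Ps} - {i}. f j)" for f :: "nat \<Rightarrow> real"
      using i by (subst prod.remove[of _ i]) auto
    have "num_cards Ps = Suc (num_cards ?Q)"
      using i by (simp add: num_cards_eq_sum split)
    then have riffle_eq: "pmf (riffle k ?Q) v
        = real (card (origins ?Q v)) * (\<Prod>j<length Ps. fact (length (?Q ! j))) / fact k"
      using Suc.IH[of ?Q v] Suc.prems w by simp
    have prod_eq: "?P = real (length (Ps ! i)) * (\<Prod>j<length Ps. fact (length (?Q ! j)))"
      using i by (simp add: split' fact_reduce)
    have drop_eq: "pmf (drop_pmf Ps) i = real (length (Ps ! i)) / real (Suc k)"
      using pmf_drop_pmf[OF pos i(1)] Suc.prems by simp
    show ?thesis unfolding riffle_eq prod_eq drop_eq by (simp add: mult_ac)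
  qed
  have card: "card (origins Ps w) = (\<Sum>i\<in>I. card (origins (Ps[i := butlast (Ps ! i)]) v))"
    unfolding w origins_snoc I_def[symmetric]
    using fI by (subst card_UN_disjoint) (auto simp: finite_origins card_image inj_on_def)
  have "pmf (riffle (Suc k) Ps) w
      = (\<Sum>i<length Ps. (if last (Ps ! i) = c then pmf (riffle k (Ps[i := butlast (Ps ! i)])) v else 0)
          * pmf (drop_pmf Ps) i)"
    unfolding riffle.simps pmf_bind
    by (subst integral_measure_pmf_real[of "{..<length Ps}"])
       (use set_drop_pmf[OF pos] in \<open>auto simp: snoc\<close>)
  also have "\<dots> = (\<Sum>i\<in>I. pmf (riffle k (Ps[i := butlast (Ps ! i)])) v * pmf (drop_pmf Ps) i)"
    by (rule sum.mono_neutral_cong_right) (auto simp: I_def pmf_drop_pmf[OF pos])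
  also have "\<dots> = (\<Sum>i\<in>I. real (card (origins (Ps[i := butlast (Ps ! i)]) v)) * ?P / fact (Suc k))"
    by (rule sum.cong[OF refl term_eq])
  also have "\<dots> = real (card (origins Ps w)) * ?P / fact (Suc k)"
    unfolding card by (simp only: of_nat_sum sum_distrib_right sum_divide_distrib)
  finally show ?case .
qed

lemma packets_map_length: "packets (map length Ps) (concat Ps) = Ps"
  by (induction Ps) auto

lemma concat_packets: "sum_list A = length xs \<Longrightarrow> concat (packets A xs) = xs"
  by (induction A xs rule: packets.induct) auto

lemma length_packets: "length (packets A xs) = length A"
  by (induction A xs rule: packets.induct) auto

lemma map_length_packets: "sum_list A \<le> length xs \<Longrightarrow> map length (packets A xs) = A"
  by (induction A xs rule: packets.induct) auto

lemma sorting_labels_eq_Union_origins: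
  assumes "length w = length xs"
  shows "sorting_labels a xs w = (\<Union>A\<in>cut_sizes a (length xs). origins (packets A xs) w)"
proof (intro equalityI subsetI)
  fix l assume l: "l \<in> sorting_labels a xs w"
  define Ps where "Ps = map (\<lambda>i. subword i l w) [0..<a]"
  have xs: "concat Ps = xs" using l by (simp add: sorting_labels_def Ps_def)
  then have "packets (map length Ps) xs = Ps" using packets_map_length[of Ps] by simp
  moreover have "map length Ps \<in> cut_sizes a (length xs)"
    using xs by (auto simp: cut_sizes_def length_concat Ps_def)
  moreover have "l \<in> origins Ps w"
    using l by (auto simp: sorting_labels_def origins_def Ps_def)
  ultimately show "l \<in> (\<Union>A\<in>cut_sizes a (length xs). origins (packets A xs) w)"
    by (intro UN_I[of "map length Ps"]) simp_all
next
  fix l assume "l \<in> (\<Union>A\<in>cut_sizes a (length xs). origins (packets A xs) w)"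
  then obtain A where A: "A \<in> cut_sizes a (length xs)" and l: "l \<in> origins (packets A xs) w" by auto
  have len: "length (packets A xs) = a" using A by (simp add: cut_sizes_def length_packets)
  have "map (\<lambda>i. subword i l w) [0..<a] = packets A xs"
    using l len by (intro nth_equalityI) (auto simp: origins_def)
  then show "l \<in> sorting_labels a xs w"
    using l len A by (auto simp: sorting_labels_def origins_def cut_sizes_def concat_packets)
qed

text \<open>
  The multinomial probability of a cut is \<open>fact n / (\<Prod>k\<leftarrow>A. fact k) / a ^ n\<close>, and each interleaving
  of its packets has the reciprocal of the multinomial coefficient as its probability. So every
  labelling has probability \<open>1 / a ^ n\<close>.
\<close>

lemma pmf_shuffle:
  assumes a: "a \<ge> 1" and w: "length w = length xs"
  shows "pmf (shuffle_pmf a xs) w = real (card (sorting_labels a xs w)) / real a ^ length xs"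
proof -
  let ?n = "length xs"
  have term_eq: "pmf (riffle ?n (packets A xs)) w * pmf (cut_pmf a ?n) A
      = real (card (origins (packets A xs) w)) / real a ^ ?n" if A: "A \<in> cut_sizes a ?n" for A
  proof -
    let ?Ps = "packets A xs"
    have lens: "map length ?Ps = A" using A by (simp add: map_length_packets cut_sizes_def)
    have "num_cards ?Ps = ?n" using A unfolding num_cards_def lens by (simp add: cut_sizes_def)
    then have "pmf (riffle ?n ?Ps) w
        = real (card (origins ?Ps w)) * (\<Prod>i<length ?Ps. fact (length (?Ps ! i))) / fact ?n"
      using w by (simp add: pmf_riffle)
    also have "(\<Prod>i<length ?Ps. fact (length (?Ps ! i)) :: real) = (\<Prod>k\<leftarrow>A. fact k)"
    proof -
      have "(\<Prod>k\<leftarrow>map length ?Ps. fact k :: real) = (\<Prod>i<length ?Ps. fact (length (?Ps ! i)))"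
        by (simp add: prod.list_conv_set_nth atLeast0LessThan)
      then show ?thesis unfolding lens by simp
    qed
    finally have "pmf (riffle ?n ?Ps) w = real (card (origins ?Ps w)) * (\<Prod>k\<leftarrow>A. fact k) / fact ?n" .
    moreover have "(\<Prod>k\<leftarrow>A. fact k :: real) \<noteq> 0" by (induction A) auto
    ultimately show ?thesis using A by (simp add: pmf_cut_pmf[OF a] cut_prob_def)
  qed
  have "pmf (shuffle_pmf a xs) w
      = (\<Sum>A\<in>cut_sizes a ?n. pmf (riffle ?n (packets A xs)) w * pmf (cut_pmf a ?n) A)"
    unfolding shuffle_pmf_def pmf_bind
    by (rule integral_measure_pmf_real)
       (auto simp: finite_cut_sizes set_pmf_eq pmf_cut_pmf[OF a] cut_prob_def split: if_splits)
  also have "\<dots> = (\<Sum>A\<in>cut_sizes a ?n. real (card (origins (packets A xs) w)) / real a ^ ?n)"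
    by (rule sum.cong[OF refl term_eq])
  also have "\<dots> = real (\<Sum>A\<in>cut_sizes a ?n. card (origins (packets A xs) w)) / real a ^ ?n"
    by (simp add: sum_divide_distrib)
  also have "(\<Sum>A\<in>cut_sizes a ?n. card (origins (packets A xs) w)) = card (sorting_labels a xs w)"
    unfolding sorting_labels_eq_Union_origins[OF w]
  proof (rule card_UN_disjoint[symmetric])
    show "\<forall>A\<in>cut_sizes a ?n. \<forall>B\<in>cut_sizes a ?n. A \<noteq> B \<longrightarrow>
        origins (packets A xs) w \<inter> origins (packets B xs) w = {}"
    proof (intro ballI impI equals0I)
      fix A B l assume AB: "A \<in> cut_sizes a ?n" "B \<in> cut_sizes a ?n" "A \<noteq> B"
        and "l \<in> origins (packets A xs) w \<inter> origins (packets B xs) w"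
      then have "packets A xs = packets B xs"
        by (intro nth_equalityI) (auto simp: origins_def cut_sizes_def length_packets)
      then have "map length (packets A xs) = map length (packets B xs)" by simp
      then show False using AB by (simp add: map_length_packets cut_sizes_def)
    qed
  qed (auto simp: finite_cut_sizes finite_origins)
  finally show ?thesis .
qed

section \<open>The least likely configuration\<close>

lemma set_subword: "set (subword i l w) = {snd p | p. p \<in> set (zip l w) \<and> fst p = i}"
  by (force simp: subword_def)

lemma mset_concat_subwords:
  assumes "length l = length w" "set l \<subseteq> {..<a}"
  shows "mset (concat (map (\<lambda>i. subword i l w) [0..<a])) = mset w"
proof (rule multiset_eqI)
  fix x
  have "(\<Sum>i<a. count (mset (subword i l w)) x) = count (mset w) x"
    using assms
  proof (induction l w rule: list_induct2)
    case Nil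
    then show ?case by (simp add: subword_def)
  next
    case (Cons j l y w)
    have "(\<Sum>i<a. count (mset (subword i (j # l) (y # w))) x)
        = (\<Sum>i<a. (if i = j then (if y = x then 1 else 0) else 0) + count (mset (subword i l w)) x)"
      by (intro sum.cong refl) (simp add: subword_def)
    also have "\<dots> = (if y = x then 1 else 0) + (\<Sum>i<a. count (mset (subword i l w)) x)"
      using Cons.prems by (simp add: sum.distrib)
    finally show ?case using Cons by simp
  qed
  moreover have "count (mset (concat (map (\<lambda>i. subword i l w) [0..<a]))) x
      = (\<Sum>i<a. count (mset (subword i l w)) x)"
    by (induction a) (auto simp: add.commute)
  ultimately show "count (mset (concat (map (\<lambda>i. subword i l w) [0..<a]))) x = count (mset w) x"
    by simp
qed

text \<open>
  These labellings sort \<open>w\<close> irrespective of the order in which its cards lie, because ties between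
  labels only occur between cards of the same type.
\<close>

definition strict_labels :: "nat \<Rightarrow> nat list \<Rightarrow> nat list set" where
  "strict_labels a w = {l. length l = length w \<and> set l \<subseteq> {..<a} \<and>
     (\<forall>p\<in>set (zip l w). \<forall>q\<in>set (zip l w). snd p < snd q \<longrightarrow> fst p < fst q)}"

lemma finite_strict_labels: "finite (strict_labels a w)"
  by (rule finite_subset[of _ "{l. set l \<subseteq> {..<a} \<and> length l = length w}"])
     (auto simp: strict_labels_def finite_lists_length_eq)

lemma finite_sorting_labels: "finite (sorting_labels a xs w)"
  by (rule finite_subset[of _ "{l. set l \<subseteq> {..<a} \<and> length l = length w}"])
     (auto simp: sorting_labels_def finite_lists_length_eq)

lemma sorted_concat_map_upt:
  "sorted (concat (map f [0..<a])) \<longleftrightarrow>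
     (\<forall>i<a. sorted (f i)) \<and> (\<forall>i j. i < j \<longrightarrow> j < a \<longrightarrow> (\<forall>x\<in>set (f i). \<forall>y\<in>set (f j). x \<le> y))"
  by (induction a) (auto simp: sorted_append less_Suc_eq)

lemma sorting_labels_iff_sorted:
  fixes xs w :: "nat list"
  assumes "sorted xs" "mset w = mset xs"
  shows "sorting_labels a xs w = {l. length l = length w \<and> set l \<subseteq> {..<a} \<and>
     sorted (concat (map (\<lambda>i. subword i l w) [0..<a]))}"
proof -
  have "ys = xs \<longleftrightarrow> sorted ys" if "mset ys = mset w" for ys
    using that assms properties_for_sort[of ys xs] sorted_sort_id[of xs] by auto
  then show ?thesis
    unfolding sorting_labels_def using mset_concat_subwords[of _ w a] by (intro Collect_cong) blast
qed

lemma strict_labels_subset_sorting_labels: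
  assumes "sorted xs" "mset w = mset xs"
  shows "strict_labels a w \<subseteq> sorting_labels a xs w"
proof
  fix l assume l: "l \<in> strict_labels a w"
  have *: "snd p \<le> snd q" if "p \<in> set (zip l w)" "q \<in> set (zip l w)" "fst p \<le> fst q" for p q
  proof (rule ccontr)
    assume "\<not> snd p \<le> snd q"
    then have "snd q < snd p" by simp
    then have "fst q < fst p" using l that(1,2) unfolding strict_labels_def by blast
    then show False using that(3) by simp
  qed
  have "sorted (subword i l w)" for i
    unfolding subword_def sorted_map
  proof (rule sorted_wrt_mono_rel)
    show "sorted_wrt (\<lambda>p q. True) (filter (\<lambda>p. fst p = i) (zip l w))"
      by (simp add: sorted_wrt_iff_nth_less)
  qed (use * in auto)
  moreover have "x \<le> y" if "i < j" "x \<in> set (subword i l w)" "y \<in> set (subword j l w)" for i j x y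
  proof -
    have "(i, x) \<in> set (zip l w)" "(j, y) \<in> set (zip l w)"
      using that by (auto simp: set_subword)
    then show ?thesis using *[of "(i, x)" "(j, y)"] that(1) by simp
  qed
  ultimately show "l \<in> sorting_labels a xs w"
    using l unfolding sorting_labels_iff_sorted[OF assms] sorted_concat_map_upt
    by (auto simp: strict_labels_def)
qed

text \<open>
  In a weakly decreasing word \<open>w\<close> a smaller card lies below every larger one. If the two had the
  same label, stable sorting would leave the larger one in front; so the labels must differ.
\<close>

lemma sorting_labels_subset_strict_labels:
  assumes "sorted xs" "mset w = mset xs" "sorted (rev w)"
  shows "sorting_labels a xs w \<subseteq> strict_labels a w"
proof
  fix l assume "l \<in> sorting_labels a xs w"
  then have l: "length l = length w" "set l \<subseteq> {..<a}"
    and s: "\<And>i. i < a \<Longrightarrow> sorted (subword i l w)"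
    and c: "\<And>i j x y. i < j \<Longrightarrow> j < a \<Longrightarrow> x \<in> set (subword i l w) \<Longrightarrow> y \<in> set (subword j l w) \<Longrightarrow> x \<le> y"
    unfolding sorting_labels_iff_sorted[OF assms(1,2)] sorted_concat_map_upt by auto
  have desc: "sorted_wrt (\<ge>) w" using assms(3) by (simp add: sorted_wrt_rev)
  have "fst p < fst q" if p: "p \<in> set (zip l w)" and q: "q \<in> set (zip l w)" and lt: "snd p < snd q" for p q
  proof (rule ccontr)
    assume ge: "\<not> fst p < fst q"
    have "fst s < a" if "s \<in> set (zip l w)" for s
      using that l(2) set_zip_leftD[of "fst s" "snd s" l w] by auto
    then have lab: "fst p < a" "fst q < a" using p q by simp_all
    consider "fst q < fst p" | "fst p = fst q" using ge by linarith
    then show False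
    proof cases
      case 1
      have "snd q \<le> snd p"
        using p q lab by (intro c[OF 1]) (auto simp: set_subword)
      then show False using lt by simp
    next
      case 2
      let ?s = "subword (fst p) l w"
      have "sorted_wrt (\<lambda>x y. snd x \<ge> snd y) (zip l w)"
        using desc l by (auto simp: sorted_wrt_iff_nth_less)
      then have "sorted_wrt (\<ge>) ?s"
        unfolding subword_def sorted_wrt_map by (rule sorted_wrt_filter)
      then have "?s ! j \<le> ?s ! i" if "i < j" "j < length ?s" for i j
        using that by (simp add: sorted_wrt_iff_nth_less)
      moreover have "?s ! i \<le> ?s ! j" if "i < j" "j < length ?s" for i j
        using s[OF lab(1)] that by (simp add: sorted_iff_nth_mono)
      ultimately have const: "?s ! i = ?s ! j" if "i < length ?s" "j < length ?s" for i j
        using that by (metis le_antisym linorder_neqE_nat)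
      have "snd p \<in> set ?s"
        unfolding set_subword mem_Collect_eq by (rule exI[of _ p]) (use p in simp)
      then obtain i where i: "i < length ?s" "?s ! i = snd p" by (meson in_set_conv_nth)
      have "snd q \<in> set ?s"
        unfolding set_subword mem_Collect_eq by (rule exI[of _ q]) (use q 2 in simp)
      then obtain j where j: "j < length ?s" "?s ! j = snd q" by (meson in_set_conv_nth)
      show False using const[OF i(1) j(1)] i(2) j(2) lt by simp
    qed
  qed
  then show "l \<in> strict_labels a w" using l by (simp add: strict_labels_def)
qed

text \<open>
  Strictness only relates the card and the label at a position, so a permutation of the positions
  can be applied to both.
\<close>

lemma card_strict_labels_le:
  assumes "mset w = mset w'"
  shows "card (strict_labels a w) \<le> card (strict_labels a w')"
proof -
  obtain \<pi> where \<pi>: "\<pi> permutes {..<length w}" "permute_list \<pi> w = w'"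
    using mset_eq_permutation[OF assms[symmetric]] by auto
  have len: "length w' = length w" using assms by (metis size_mset)
  show ?thesis
  proof (rule card_inj_on_le)
    show "finite (strict_labels a w')" by (rule finite_strict_labels)
    show "inj_on (permute_list \<pi>) (strict_labels a w)"
    proof (rule inj_onI)
      fix l l' assume l: "l \<in> strict_labels a w" "l' \<in> strict_labels a w"
        and eq: "permute_list \<pi> l = permute_list \<pi> l'"
      have inv: "permute_list (inv \<pi>) (permute_list \<pi> m) = m" if "length m = length w" for m :: "nat list"
        using permute_list_compose[of "inv \<pi>" m \<pi>] permutes_inv[OF \<pi>(1)] that
        by (simp add: permutes_inv_o(1)[OF \<pi>(1)])
      have len_l: "length l = length w" "length l' = length w"
        using l unfolding strict_labels_def by auto
      have "l = permute_list (inv \<pi>) (permute_list \<pi> l)" by (rule inv[OF len_l(1), symmetric])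
      also have "\<dots> = l'" unfolding eq by (rule inv[OF len_l(2)])
      finally show "l = l'" .
    qed
    show "permute_list \<pi> ` strict_labels a w \<subseteq> strict_labels a w'"
    proof safe
      fix l assume l: "l \<in> strict_labels a w"
      then have len': "length l = length w" by (simp add: strict_labels_def)
      have "zip (permute_list \<pi> l) w' = permute_list \<pi> (zip l w)"
        using \<pi> len' by (simp add: permute_list_zip)
      then have "set (zip (permute_list \<pi> l) w') = set (zip l w)"
        using \<pi> len' by (simp add: set_permute_list)
      moreover have "set (permute_list \<pi> l) = set l"
        using \<pi> len' by (simp add: set_permute_list)
      ultimately show "permute_list \<pi> l \<in> strict_labels a w'"
        using l len by (simp add: strict_labels_def)
    qed
  qed
qed

lemma card_strict_labels_mset:
  "mset w = mset w' \<Longrightarrow> card (strict_labels a w) = card (strict_labels a w')"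
  by (intro antisym card_strict_labels_le) simp_all

lemma card_lists_with_min:
  assumes "r > 0" "c < a"
  shows "card {l. length l = r \<and> set l \<subseteq> {c..<a} \<and> c \<in> set l} = (a - c) ^ r - (a - c - 1) ^ r"
proof -
  have "{l. length l = r \<and> set l \<subseteq> {c..<a} \<and> c \<in> set l}
      = {l. set l \<subseteq> {c..<a} \<and> length l = r} - {l. set l \<subseteq> {Suc c..<a} \<and> length l = r}"
  proof -
    have "{Suc c..<a} = {c..<a} - {c}" by auto
    then show ?thesis by auto
  qed
  moreover have "{l. set l \<subseteq> {Suc c..<a} \<and> length l = r} \<subseteq> {l. set l \<subseteq> {c..<a} \<and> length l = r}"
    by auto
  ultimately show ?thesis
    by (simp add: card_Diff_subset finite_lists_length_eq card_lists_length_eq)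
qed

text \<open>
  The labellings are grouped by the smallest label \<open>c\<close> on the new, largest type \<open>x\<close>: all cards of
  \<open>w\<close> must then have labels below \<open>c\<close>.
\<close>

lemma strict_labels_append_replicate:
  assumes x: "\<And>y. y \<in> set w \<Longrightarrow> y < x" and r: "r > 0"
  shows "strict_labels a (w @ replicate r x)
    = (\<Union>c<a. (\<lambda>(l, l'). l @ l') `
        (strict_labels c w \<times> {l'. length l' = r \<and> set l' \<subseteq> {c..<a} \<and> c \<in> set l'}))"
    (is "?L = ?R")
proof (intro equalityI subsetI)
  fix m assume m: "m \<in> ?L"
  define l where "l = take (length w) m"
  define l' where "l' = drop (length w) m"
  have len: "length l = length w" "length l' = r" and ml: "m = l @ l'"
    using m by (auto simp: l_def l'_def strict_labels_def)
  have z: "zip m (w @ replicate r x) = zip l w @ map (\<lambda>i. (i, x)) l'"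
    using len by (simp add: ml zip_replicate2)
  define c where "c = Min (set l')"
  have ne: "set l' \<noteq> {}" using len r by auto
  have c: "c \<in> set l'" "\<And>i. i \<in> set l' \<Longrightarrow> c \<le> i" using ne by (auto simp: c_def)
  have "i < c" if i: "i \<in> set l" for i
  proof -
    obtain y where y: "(i, y) \<in> set (zip l w)" "y \<in> set w"
      using i len by (metis in_set_impl_in_set_zip1 set_zip_rightD)
    have "(i, y) \<in> set (zip m (w @ replicate r x))" "(c, x) \<in> set (zip m (w @ replicate r x))"
      using y c by (auto simp: z)
    then have "snd (i, y) < snd (c, x) \<longrightarrow> fst (i, y) < fst (c, x)"
      using m unfolding strict_labels_def by blast
    then show ?thesis using x[OF y(2)] by simp
  qed
  then have "l \<in> strict_labels c w"
    using m len by (auto simp: strict_labels_def z)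
  moreover have "set l' \<subseteq> {c..<a}" "c < a" using m c by (auto simp: strict_labels_def ml)
  ultimately show "m \<in> ?R" using c len ml by (auto intro!: bexI[of _ c] image_eqI[of _ _ "(l, l')"])
next
  fix m assume "m \<in> ?R"
  then obtain c l l' where c: "c < a" and l: "l \<in> strict_labels c w"
    and l': "length l' = r" "set l' \<subseteq> {c..<a}" and m: "m = l @ l'" by auto
  have len: "length l = length w" using l by (simp add: strict_labels_def)
  have z: "zip m (w @ replicate r x) = zip l w @ map (\<lambda>i. (i, x)) l'"
    using len l' by (simp add: m zip_replicate2)
  have lt: "fst p < c" "snd p < x" if "p \<in> set (zip l w)" for p
  proof -
    have "fst p \<in> set l" "snd p \<in> set w"
      using that set_zip_leftD[of "fst p" "snd p" l w] set_zip_rightD[of "fst p" "snd p" l w] by auto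
    then show "fst p < c" "snd p < x" using l x by (auto simp: strict_labels_def)
  qed
  have "set l \<subseteq> {..<a}" using l c by (auto simp: strict_labels_def)
  moreover have "fst p < fst q" if "p \<in> set (zip m (w @ replicate r x))" "q \<in> set (zip m (w @ replicate r x))" "snd p < snd q" for p q
  proof -
    have parts: "s \<in> set (zip l w) \<or> (snd s = x \<and> c \<le> fst s)" if "s \<in> set (zip m (w @ replicate r x))" for s
      using that l'(2) unfolding z by auto
    have in_w: "p \<in> set (zip l w)"
      using parts[OF that(1)] parts[OF that(2)] that(3) lt(2)[of q] by auto
    show ?thesis
    proof (cases "q \<in> set (zip l w)")
      case True
      then show ?thesis using l in_w that(3) unfolding strict_labels_def by blast
    next
      case False
      then show ?thesis using parts[OF that(2)] lt(1)[OF in_w] by simp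
    qed
  qed
  ultimately show "m \<in> ?L" using l' len by (auto simp: strict_labels_def m)
qed

text \<open>
  Here \<open>b = a - c\<close> is the number of labels from the smallest label \<open>c\<close> of the new type upwards.
\<close>

lemma card_strict_labels_append_replicate:
  assumes x: "\<And>y. y \<in> set w \<Longrightarrow> y < x" and r: "r > 0"
  shows "card (strict_labels a (w @ replicate r x))
    = (\<Sum>b=1..a. (b ^ r - (b - 1) ^ r) * card (strict_labels (a - b) w))"
proof -
  let ?M = "\<lambda>c. {l'. length l' = r \<and> set l' \<subseteq> {c..<a} \<and> c \<in> set l'}"
  let ?S = "\<lambda>c. (\<lambda>(l, l'). l @ l') ` (strict_labels c w \<times> ?M c)"
  have finM: "finite (?M c)" for c
    by (rule finite_subset[of _ "{l. set l \<subseteq> {c..<a} \<and> length l = r}"]) (auto simp: finite_lists_length_eq)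
  have card_S: "card (\<Union>c<a. ?S c) = (\<Sum>c<a. card (?S c))"
  proof (rule card_UN_disjoint)
    show "\<forall>c\<in>{..<a}. \<forall>c'\<in>{..<a}. c \<noteq> c' \<longrightarrow> ?S c \<inter> ?S c' = {}"
    proof (intro ballI impI equals0I)
      fix c c' m assume ne: "c \<noteq> c'" and m: "m \<in> ?S c \<inter> ?S c'"
      have last: "drop (length w) m \<in> ?M b" if "m \<in> ?S b" for b
        using that by (auto simp: strict_labels_def)
      have "drop (length w) m \<in> ?M c" "drop (length w) m \<in> ?M c'"
        using m last[of c] last[of c'] by blast+
      then have "c \<le> c'" "c' \<le> c" by auto
      then show False using ne by simp
    qed
  qed (auto intro!: finite_imageI finite_cartesian_product finite_strict_labels finM)
  have "card (strict_labels a (w @ replicate r x)) = (\<Sum>c<a. card (?S c))"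
  proof -
    have "strict_labels a (w @ replicate r x) = (\<Union>c<a. ?S c)"
      by (rule strict_labels_append_replicate[OF _ r]) (rule x)
    then show ?thesis by (simp only: card_S)
  qed
  also have "\<dots> = (\<Sum>c<a. ((a - c) ^ r - (a - c - 1) ^ r) * card (strict_labels c w))"
  proof (rule sum.cong[OF refl])
    fix c assume c: "c \<in> {..<a}"
    have "inj_on (\<lambda>(l, l'). l @ l') (strict_labels c w \<times> ?M c)"
      by (auto simp: inj_on_def strict_labels_def)
    then show "card (?S c) = ((a - c) ^ r - (a - c - 1) ^ r) * card (strict_labels c w)"
      using c by (simp add: card_image card_cartesian_product card_lists_with_min[OF r])
  qed
  also have "\<dots> = (\<Sum>b=1..a. (b ^ r - (b - 1) ^ r) * card (strict_labels (a - b) w))"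
    by (rule sum.reindex_bij_witness[of _ "\<lambda>b. a - b" "\<lambda>c. a - c"]) auto
  finally show ?thesis .
qed

lemma strict_labels_replicate:
  "strict_labels a (replicate r x) = {l. set l \<subseteq> {..<a} \<and> length l = r}"
  by (auto simp: strict_labels_def dest!: set_zip_rightD)

lemma deck_Suc: "deck (Suc m) D = deck m D @ replicate (D (Suc m)) (Suc m)"
  by (simp add: deck_def)

lemma sorted_deck: "sorted (deck m D)"
proof (induction m)
  case 0
  show ?case by (simp add: deck_def)
next
  case (Suc m)
  have "set (deck m D) \<subseteq> {1..m}"
    using deck_in_configurations[of m D] by (simp add: configurations_def)
  then show ?case using Suc by (auto simp: deck_Suc sorted_append)
qed

lemma length_deck: "length (deck m D) = (\<Sum>i=1..m. D i)"
  by (induction m) (simp_all add: deck_def)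

text \<open>
  Equal multisets of cards provide a permutation between any two configurations.
\<close>

lemma configurations_eq: "configurations m D = {w. mset w = mset (deck m D)}"
proof (intro equalityI subsetI CollectI)
  fix w assume w: "w \<in> configurations m D"
  have "count_list w x = count_list (deck m D) x" for x
  proof (cases "x \<in> {1..m}")
    case True
    then show ?thesis using w deck_in_configurations[of m D] by (simp add: configurations_def)
  next
    case False
    then have "x \<notin> set w" "x \<notin> set (deck m D)"
      using w deck_in_configurations[of m D] by (auto simp: configurations_def)
    then show ?thesis by (simp add: count_list_0_iff)
  qed
  then show "mset w = mset (deck m D)" by (intro multiset_eqI) (simp add: count_mset)
next
  fix w assume "w \<in> {w. mset w = mset (deck m D)}"
  then have w: "mset w = mset (deck m D)" by simp
  have "set w = set (deck m D)" using w by (rule mset_eq_setD)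
  moreover have "count_list w x = count_list (deck m D) x" for x
    using arg_cong[OF w, of "\<lambda>M. count M x"] by (simp add: count_mset)
  ultimately show "w \<in> configurations m D"
    using deck_in_configurations[of m D] by (simp add: configurations_def)
qed

text \<open>
  Every configuration is obtained from at least as many labellings as there are strict ones, and
  the reversed deck from no others. So the maximum is attained at the reversed deck.
\<close>

lemma separation_distance_eq:
  assumes "a \<ge> 1"
  shows "separation_distance a m D = 1 - real (card (strict_labels a (deck m D)))
    / real a ^ (\<Sum>i=1..m. D i) / uniform_prob m D"
proof -
  let ?q = "real (card (strict_labels a (deck m D))) / real a ^ (\<Sum>i=1..m. D i)"
  have U: "uniform_prob m D > 0" by (simp add: uniform_prob_def prod_pos)
  have pmf_eq: "pmf (shuffle_pmf a (deck m D)) w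
      = real (card (sorting_labels a (deck m D) w)) / real a ^ (\<Sum>i=1..m. D i)"
    if "mset w = mset (deck m D)" for w
    using pmf_shuffle[OF assms, of w "deck m D"] mset_eq_length[OF that] by (simp add: length_deck)
  have lower: "?q \<le> pmf (shuffle_pmf a (deck m D)) w" if w: "mset w = mset (deck m D)" for w
  proof -
    have "card (strict_labels a (deck m D)) = card (strict_labels a w)"
      by (rule card_strict_labels_mset[OF w[symmetric]])
    also have "\<dots> \<le> card (sorting_labels a (deck m D) w)"
      by (intro card_mono finite_sorting_labels strict_labels_subset_sorting_labels sorted_deck w)
    finally show ?thesis unfolding pmf_eq[OF w] by (intro divide_right_mono) simp_all
  qed
  have attained: "pmf (shuffle_pmf a (deck m D)) (rev (deck m D)) = ?q"
  proof -
    have r: "mset (rev (deck m D)) = mset (deck m D)" by simp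
    have "sorting_labels a (deck m D) (rev (deck m D)) = strict_labels a (rev (deck m D))"
      using sorted_deck[of m D]
      by (intro equalityI sorting_labels_subset_strict_labels strict_labels_subset_sorting_labels) simp_all
    then show ?thesis unfolding pmf_eq[OF r] using card_strict_labels_mset[OF r, of a] by simp
  qed
  show ?thesis
    unfolding separation_distance_def
  proof (rule Max_eqI)
    show "1 - ?q / uniform_prob m D
        \<in> (\<lambda>w. 1 - pmf (shuffle_pmf a (deck m D)) w / uniform_prob m D) ` configurations m D"
      by (rule image_eqI[of _ _ "rev (deck m D)"]) (simp_all add: attained configurations_eq)
  next
    fix y assume "y \<in> (\<lambda>w. 1 - pmf (shuffle_pmf a (deck m D)) w / uniform_prob m D) ` configurations m D"
    then obtain w where w: "mset w = mset (deck m D)"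
      "y = 1 - pmf (shuffle_pmf a (deck m D)) w / uniform_prob m D"
      by (auto simp: configurations_eq)
    have "?q / uniform_prob m D \<le> pmf (shuffle_pmf a (deck m D)) w / uniform_prob m D"
      using lower[OF w(1)] U by (intro divide_right_mono) simp_all
    then show "y \<le> 1 - ?q / uniform_prob m D" unfolding w(2) by simp
  qed (simp add: finite_configurations)
qed

section \<open>Truncated powers and the trapezoidal rule\<close>

definition dpow :: "nat \<Rightarrow> real \<Rightarrow> real" where
  "dpow q x = x ^ q / fact q"

text \<open>
  The truncation extends divided powers by \<open>0\<close> to the left, so that sums and backward differences need
  no side conditions on their ranges. Differentiation lowers the index by one.
\<close>

definition tpow :: "nat \<Rightarrow> real \<Rightarrow> real" where
  "tpow q x = dpow q (max 0 x)"

lemma dpow_zero [simp]: "q > 0 \<Longrightarrow> dpow q 0 = 0"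
  by (simp add: dpow_def)

lemma dpow_nonneg: "x \<ge> 0 \<Longrightarrow> dpow q x \<ge> 0"
  by (simp add: dpow_def)

lemma tpow_nonneg: "tpow q x \<ge> 0"
  by (simp add: tpow_def dpow_nonneg)

lemma tpow_eq_dpow: "x \<ge> 0 \<Longrightarrow> tpow q x = dpow q x"
  by (simp add: tpow_def)

lemma tpow_nonpos: "x \<le> 0 \<Longrightarrow> q > 0 \<Longrightarrow> tpow q x = 0"
  by (simp add: tpow_def max_def)

lemma has_real_derivative_dpow:
  assumes "(f has_real_derivative f') (at x)"
  shows "((\<lambda>x. dpow (Suc q) (f x)) has_real_derivative dpow q (f x) * f') (at x)"
  unfolding dpow_def
  by (rule derivative_eq_intros assms refl | simp)+

lemma has_real_derivative_tpow:
  assumes "q > 0"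
  shows "(tpow (Suc q) has_real_derivative tpow q x) (at x)"
proof -
  consider "x < 0" | "x = 0" | "x > 0" by linarith
  then show ?thesis
  proof cases
    case 1
    have "((\<lambda>x. 0) has_real_derivative 0) (at x)" by simp
    then have "(tpow (Suc q) has_real_derivative 0) (at x)"
      by (rule has_field_derivative_transform_within_open[of _ _ _ "{..<0}"])
         (use 1 in \<open>auto simp: tpow_nonpos\<close>)
    then show ?thesis using 1 assms by (simp add: tpow_nonpos)
  next
    case 2
    have "(\<lambda>h. tpow (Suc q) h / h) \<midarrow>0\<rightarrow> 0"
    proof (rule Lim_transform_eventually)
      have "isCont (\<lambda>h::real. max 0 h ^ q / fact (Suc q)) 0"
        by (intro continuous_intros) auto
      then show "(\<lambda>h::real. max 0 h ^ q / fact (Suc q)) \<midarrow>0\<rightarrow> 0"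
        using assms by (simp add: isCont_def zero_power)
      show "\<forall>\<^sub>F h in at 0. max 0 h ^ q / fact (Suc q) = tpow (Suc q) h / h"
        unfolding eventually_at_filter
        using assms by (auto simp: tpow_def dpow_def max_def)
    qed
    then show ?thesis using 2 assms
      by (simp add: DERIV_def tpow_nonpos)
  next
    case 3
    have "((\<lambda>x. dpow (Suc q) x) has_real_derivative dpow q x * 1) (at x)"
      by (rule has_real_derivative_dpow) (rule DERIV_ident)
    then have "(tpow (Suc q) has_real_derivative dpow q x * 1) (at x)"
      by (rule has_field_derivative_transform_within_open[of _ _ _ "{0<..}"])
         (use 3 in \<open>auto simp: tpow_eq_dpow\<close>)
    then show ?thesis using 3 by (simp add: tpow_eq_dpow)
  qed
qed

text \<open>
  Integrating an inequality between functions over \<open>[x, y]\<close>, without integrals: an estimate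
  \<open>\<bar>u'\<bar> \<le> v'\<close> is inherited by the increments of \<open>u\<close> and \<open>v\<close>. This is how every estimate below is
  averaged over a shift of its argument.
\<close>

lemma abs_diff_le_of_deriv:
  fixes u v :: "real \<Rightarrow> real"
  assumes "x \<le> y"
    and "\<And>z. x \<le> z \<Longrightarrow> z \<le> y \<Longrightarrow> (u has_real_derivative u' z) (at z)"
    and "\<And>z. x \<le> z \<Longrightarrow> z \<le> y \<Longrightarrow> (v has_real_derivative v' z) (at z)"
    and "\<And>z. x \<le> z \<Longrightarrow> z \<le> y \<Longrightarrow> \<bar>u' z\<bar> \<le> v' z"
  shows "\<bar>u y - u x\<bar> \<le> v y - v x"
proof -
  have "v x - u x \<le> v y - u y"
  proof (rule DERIV_nonneg_imp_nondecreasing[OF assms(1)])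
    fix z assume z: "x \<le> z" "z \<le> y"
    then show "\<exists>w. ((\<lambda>z. v z - u z) has_real_derivative w) (at z) \<and> 0 \<le> w"
      using assms(4)[OF z] by (intro exI[of _ "v' z - u' z"] conjI DERIV_diff assms) auto
  qed
  moreover have "v x + u x \<le> v y + u y"
  proof (rule DERIV_nonneg_imp_nondecreasing[OF assms(1)])
    fix z assume z: "x \<le> z" "z \<le> y"
    then show "\<exists>w. ((\<lambda>z. v z + u z) has_real_derivative w) (at z) \<and> 0 \<le> w"
      using assms(4)[OF z] by (intro exI[of _ "v' z + u' z"] conjI DERIV_add assms) auto
  qed
  ultimately show ?thesis by linarith
qed

text \<open>
  The Beta integral over \<open>[t, A]\<close>, stated through an antiderivative. Integration by parts moves one
  power from the second factor to the first, and the boundary terms vanish until the second factor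
  is constant.
\<close>

lemma beta_antiderivative:
  "\<exists>G. (\<forall>x. (G has_real_derivative dpow p (x - t) * dpow q (A - x)) (at x)) \<and>
       G A - G t = dpow (p + q + 1) (A - t)"
proof (induction q arbitrary: p)
  case 0
  have "((\<lambda>x. dpow (Suc p) (x - t)) has_real_derivative dpow p (x - t) * 1) (at x)" for x
    by (intro has_real_derivative_dpow) (auto intro!: derivative_eq_intros)
  then show ?case by (intro exI[of _ "\<lambda>x. dpow (Suc p) (x - t)"]) (simp add: dpow_def)
next
  case (Suc q)
  obtain G where G: "\<And>x. (G has_real_derivative dpow (Suc p) (x - t) * dpow q (A - x)) (at x)"
    "G A - G t = dpow (Suc p + q + 1) (A - t)"
    using Suc.IH[of "Suc p"] by auto
  let ?H = "\<lambda>x. dpow (Suc p) (x - t) * dpow (Suc q) (A - x) + G x"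
  have "(?H has_real_derivative dpow p (x - t) * dpow (Suc q) (A - x)) (at x)" for x
    by (rule derivative_eq_intros has_real_derivative_dpow G refl | simp)+
  moreover have "?H A - ?H t = dpow (p + Suc q + 1) (A - t)"
    using G(2) by simp
  ultimately show ?case by (intro exI[of _ ?H]) simp
qed

text \<open>
  The Peano kernel of the trapezoidal rule on \<open>[b, b + 1]\<close> is \<open>K x = (x - b) * (b + 1 - x) / 2\<close>. The
  function \<open>M = g' K - g K' - G\<close> has derivative \<open>g'' K\<close>, as \<open>K'' = -1\<close>. Writing \<open>g''\<close> as the difference
  of the nonnegative functions \<open>g'' + N\<close> and \<open>N\<close> and using \<open>0 \<le> K \<le> 1 / 8\<close> bounds its increments
  on both sides by increments of the antiderivatives \<open>V\<close> of \<open>N\<close> and \<open>g' + V\<close> of \<open>g'' + N\<close>. The interval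
  \<open>[c, e]\<close> may be shorter than \<open>[b, b + 1]\<close>, which is needed at the two ends of the support of \<open>g\<close>.
\<close>

lemma trapezoid_remainder:
  fixes g g' g'' G V N :: "real \<Rightarrow> real"
  assumes "b \<le> c" "c \<le> e" "e \<le> b + 1"
    and G: "\<And>x. (G has_real_derivative g x) (at x)"
    and g: "\<And>x. (g has_real_derivative g' x) (at x)"
    and g': "\<And>x. (g' has_real_derivative g'' x) (at x)"
    and V: "\<And>x. (V has_real_derivative N x) (at x)"
    and N: "\<And>x. c \<le> x \<Longrightarrow> x \<le> e \<Longrightarrow> 0 \<le> N x"
    and P: "\<And>x. c \<le> x \<Longrightarrow> x \<le> e \<Longrightarrow> 0 \<le> g'' x + N x"
  defines "M \<equiv> \<lambda>x. g' x * ((x - b) * (b + 1 - x) / 2) - g x * (b + 1 / 2 - x) - G x"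
  shows "- (V e - V c) / 8 \<le> M e - M c"
    and "M e - M c \<le> (g' e - g' c + (V e - V c)) / 8"
proof -
  define K where "K = (\<lambda>x. (x - b) * (b + 1 - x) / 2)"
  have K: "0 \<le> K x" "K x \<le> 1 / 8" if "c \<le> x" "x \<le> e" for x
  proof -
    show "0 \<le> K x" using that assms(1,3) by (auto simp: K_def)
    have "1 / 8 - K x = (x - b - 1 / 2)\<^sup>2 / 2"
      by (simp add: K_def power2_eq_square field_simps)
    then show "K x \<le> 1 / 8" using zero_le_power2[of "x - b - 1 / 2"] by linarith
  qed
  have M: "(M has_real_derivative g'' x * K x) (at x)" for x
    unfolding M_def K_def
    by (rule derivative_eq_intros G g g' refl | simp)+
  have "M c + V c / 8 \<le> M e + V e / 8"
  proof (rule DERIV_nonneg_imp_nondecreasing[OF assms(2)])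
    fix x assume x: "c \<le> x" "x \<le> e"
    have "0 \<le> (g'' x + N x) * K x + N x * (1 / 8 - K x)"
      using K[OF x] N[OF x] P[OF x] by (intro add_nonneg_nonneg[OF mult_nonneg_nonneg mult_nonneg_nonneg]) auto
    then show "\<exists>y. ((\<lambda>x. M x + V x / 8) has_real_derivative y) (at x) \<and> 0 \<le> y"
      by (intro exI[of _ "g'' x * K x + N x / 8"] conjI DERIV_add M DERIV_cdivide V)
         (simp add: field_simps)
  qed
  then show "- (V e - V c) / 8 \<le> M e - M c" by (simp add: field_simps)
  have "(g' c + V c) / 8 - M c \<le> (g' e + V e) / 8 - M e"
  proof (rule DERIV_nonneg_imp_nondecreasing[OF assms(2)])
    fix x assume x: "c \<le> x" "x \<le> e"
    have "0 \<le> (g'' x + N x) * (1 / 8 - K x) + N x * K x"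
      using K[OF x] N[OF x] P[OF x] by (intro add_nonneg_nonneg[OF mult_nonneg_nonneg mult_nonneg_nonneg]) auto
    then show "\<exists>y. ((\<lambda>x. (g' x + V x) / 8 - M x) has_real_derivative y) (at x) \<and> 0 \<le> y"
      by (intro exI[of _ "(g'' x + N x) / 8 - g'' x * K x"]
          conjI DERIV_diff M DERIV_cdivide DERIV_add V g')
         (simp add: field_simps)
  qed
  then show "M e - M c \<le> (g' e - g' c + (V e - V c)) / 8" by (simp add: field_simps)
qed

text \<open>
  The factor \<open>u ^ k / fact (k + 2)\<close> is common to the divided powers with index \<open>k\<close>, \<open>k + 1\<close> and
  \<open>k + 2\<close>, which are \<open>dpow (k + 2)\<close> and its first two derivatives.
\<close>

lemma dpow_eq_factor:
  "dpow k u = real (k + 1) * (real (k + 2) * (u ^ k / fact (k + 2)))"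
  "dpow (k + 1) u = real (k + 2) * (u * (u ^ k / fact (k + 2)))"
  "dpow (k + 2) u = u\<^sup>2 * (u ^ k / fact (k + 2))"
proof -
  have f: "fact (k + 2) = real (k + 2) * fact (k + 1)" "fact (k + 1) = real (k + 1) * fact k"
    by simp_all
  have nz: "real (k + 2) \<noteq> 0" "real (k + 1) \<noteq> 0" by simp_all
  show "dpow k u = real (k + 1) * (real (k + 2) * (u ^ k / fact (k + 2)))"
    unfolding f dpow_def using nz by (simp only: divide_simps mult_ac) simp
  show "dpow (k + 1) u = real (k + 2) * (u * (u ^ k / fact (k + 2)))"
    unfolding f(1) dpow_def using nz by (simp only: divide_simps mult_ac) simp
  show "dpow (k + 2) u = u\<^sup>2 * (u ^ k / fact (k + 2))"
    unfolding dpow_def by (simp add: power2_eq_square)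
qed

text \<open>
  For \<open>g x = dpow (p + 1) u * dpow (q + 1) v\<close> with \<open>u = x - t\<close> and \<open>v = A - x\<close>, and with
  \<open>C = u ^ (p - 1) / fact (p + 1)\<close> and \<open>E = v ^ (q - 1) / fact (q + 1)\<close> from \<open>dpow_eq_factor\<close>, the first three
  terms on the left are \<open>g''\<close>, and the rest is
  \<open>g * ((p + 1) / u\<^sup>2 + (q + 1) / v\<^sup>2)\<close>. Together they are
  \<open>g * ((p + 1) / u - (q + 1) / v)\<^sup>2\<close>, written here without division by \<open>u\<close> and \<open>v\<close>.
\<close>

lemma second_derivative_square:
  fixes p q u v C E :: real
  assumes "p \<noteq> 0" "q \<noteq> 0"
  shows "(p * ((p+1) * C)) * (v\<^sup>2 * E) - 2 * (((p+1) * (u * C)) * ((q+1) * (v * E)))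
      + (u\<^sup>2 * C) * (q * ((q+1) * E))
      + ((p * ((p+1) * C)) * (v\<^sup>2 * E) / p + (u\<^sup>2 * C) * (q * ((q+1) * E)) / q)
    = C * E * ((p+1) * v - (q+1) * u)\<^sup>2"
proof -
  have "(p * ((p+1) * C)) * (v\<^sup>2 * E) / p = ((p+1) * C) * (v\<^sup>2 * E)"
    "(u\<^sup>2 * C) * (q * ((q+1) * E)) / q = (u\<^sup>2 * C) * ((q+1) * E)" using assms by auto
  then show ?thesis by (simp only: power2_eq_square) (simp add: algebra_simps)
qed

text \<open>
  The trapezoidal rule is applied to \<open>g x = dpow (p + 2) (x - t) * dpow (q + 2) (A - x)\<close> on \<open>[t, A]\<close>, cut
  at the integers. Since \<open>g\<close> vanishes at \<open>t\<close> and \<open>A\<close>, the trapezoidal sum is the plain sum of \<open>g\<close> over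
  the integers in between. The exponents \<open>p + 2\<close> and \<open>q + 2\<close> are at least \<open>2\<close>, so that \<open>g'\<close> vanishes at
  both ends as well and the remainder terms telescope.
\<close>

lemma sum_tpow_tpow_pos:
  fixes t A :: real and N p q :: nat
  assumes t: "0 \<le> t" and A: "A \<le> real N" and tA: "t \<le> A"
  shows "\<bar>(\<Sum>b=1..N. tpow (p + 2) (real b - t) * tpow (q + 2) (A - real b))
            - tpow (p + q + 5) (A - t)\<bar>
         \<le> (1 / real (p + 1) + 1 / real (q + 1)) / 8 * tpow (p + q + 3) (A - t)"
proof -
  define g where "g = (\<lambda>x. dpow (p + 2) (x - t) * dpow (q + 2) (A - x))"
  define g' where "g' = (\<lambda>x. dpow (p + 1) (x - t) * dpow (q + 2) (A - x)
    - dpow (p + 2) (x - t) * dpow (q + 1) (A - x))"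
  define g'' where "g'' = (\<lambda>x. dpow p (x - t) * dpow (q + 2) (A - x)
    - 2 * (dpow (p + 1) (x - t) * dpow (q + 1) (A - x)) + dpow (p + 2) (x - t) * dpow q (A - x))"
  define Nf where "Nf = (\<lambda>x. dpow p (x - t) * dpow (q + 2) (A - x) / real (p + 1)
    + dpow (p + 2) (x - t) * dpow q (A - x) / real (q + 1))"
  obtain G where G: "\<And>x. (G has_real_derivative g x) (at x)"
    "G A - G t = dpow (p + q + 5) (A - t)"
    using beta_antiderivative[of "p + 2" t "q + 2" A] by (auto simp: g_def add.commute add.left_commute numeral_eq_Suc)
  obtain V1 where V1: "\<And>x. (V1 has_real_derivative dpow p (x - t) * dpow (q + 2) (A - x)) (at x)"
    "V1 A - V1 t = dpow (p + q + 3) (A - t)"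
    using beta_antiderivative[of p t "q + 2" A] by (auto simp: add.commute add.left_commute numeral_eq_Suc)
  obtain V2 where V2: "\<And>x. (V2 has_real_derivative dpow (p + 2) (x - t) * dpow q (A - x)) (at x)"
    "V2 A - V2 t = dpow (p + q + 3) (A - t)"
    using beta_antiderivative[of "p + 2" t q A] by (auto simp: add.commute add.left_commute numeral_eq_Suc)
  define V where "V = (\<lambda>x. V1 x / real (p + 1) + V2 x / real (q + 1))"
  have V: "(V has_real_derivative Nf x) (at x)" for x
    unfolding V_def Nf_def by (intro DERIV_add DERIV_cdivide V1 V2)
  have V_diff: "V A - V t = (1 / real (p + 1) + 1 / real (q + 1)) * dpow (p + q + 3) (A - t)"
  proof -
    have "V A - V t = (V1 A - V1 t) / real (p + 1) + (V2 A - V2 t) / real (q + 1)"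
      by (simp add: V_def diff_divide_distrib)
    then show ?thesis by (simp only: V1 V2) (simp add: field_simps)
  qed
  have dg: "(g has_real_derivative g' x) (at x)" for x
    unfolding g_def g'_def add_2_eq_Suc' Suc_eq_plus1[symmetric]
    by (rule derivative_eq_intros has_real_derivative_dpow refl | simp)+
  have dg': "(g' has_real_derivative g'' x) (at x)" for x
    unfolding g'_def g''_def add_2_eq_Suc' Suc_eq_plus1[symmetric]
    by (rule derivative_eq_intros has_real_derivative_dpow refl | simp)+
  have Nf: "0 \<le> Nf x" if "t \<le> x" "x \<le> A" for x
    using that unfolding Nf_def by (intro add_nonneg_nonneg divide_nonneg_nonneg mult_nonneg_nonneg dpow_nonneg) auto
  have sq: "g'' x + Nf x = (x - t) ^ p * (A - x) ^ q / (fact (p + 2) * fact (q + 2))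
      * (real (p + 2) * (A - x) - real (q + 2) * (x - t))\<^sup>2" for x
  proof -
    define C where "C = (x - t) ^ p / fact (p + 2)"
    define E where "E = (A - x) ^ q / fact (q + 2)"
    have C': "(x - t) ^ p * (A - x) ^ q / (fact (p + 2) * fact (q + 2)) = C * E"
      by (simp add: C_def E_def)
    have r: "real (p + 2) = real (p + 1) + 1" "real (q + 2) = real (q + 1) + 1" by simp_all
    show ?thesis
      unfolding g''_def Nf_def dpow_eq_factor[of p] dpow_eq_factor[of q] C_def[symmetric] E_def[symmetric] C' r
      by (rule second_derivative_square) simp_all
  qed
  have P: "0 \<le> g'' x + Nf x" if "t \<le> x" "x \<le> A" for x
    using that unfolding sq by (intro mult_nonneg_nonneg divide_nonneg_nonneg) auto
  have ends: "g t = 0" "g A = 0" "g' t = 0" "g' A = 0"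
    by (auto simp: g_def g'_def)
  \<comment> \<open>The integers clamped to \<open>[t, A]\<close>: the end points are repeated
    outside, where they contribute nothing.\<close>
  define c where "c = (\<lambda>b::nat. max t (min (real b) A))"
  have c0: "c 0 = t" using t tA by (auto simp: c_def)
  have cN: "c N = A" using A tA by (auto simp: c_def)
  have c_in: "t \<le> c b" "c b \<le> A" for b using tA by (auto simp: c_def)
  have c_cases: "c b = real b \<or> c b = t \<or> c b = A" for b by (auto simp: c_def max_def min_def)
  have g_c: "g (c b) = tpow (p + 2) (real b - t) * tpow (q + 2) (A - real b)" for b
    using tA by (auto simp: c_def g_def tpow_def max_def min_def)
  have step: "- (V (c (Suc b)) - V (c b)) / 8
        \<le> (g (c b) + g (c (Suc b))) / 2 - (G (c (Suc b)) - G (c b))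
      \<and> (g (c b) + g (c (Suc b))) / 2 - (G (c (Suc b)) - G (c b))
        \<le> (g' (c (Suc b)) - g' (c b) + (V (c (Suc b)) - V (c b))) / 8" for b
  proof (cases "c b < c (Suc b)")
    case False
    then have eq: "c (Suc b) = c b" using tA by (auto simp: c_def max_def min_def split: if_splits)
    then have "c b = t \<or> c b = A" by (auto simp: c_def max_def min_def split: if_splits)
    then show ?thesis using eq ends by auto
  next
    case True
    then have le: "real b \<le> c b" "c b \<le> c (Suc b)" "c (Suc b) \<le> real b + 1"
      using tA by (auto simp: c_def max_def min_def split: if_splits)
    define M where "M = (\<lambda>x. g' x * ((x - real b) * (real b + 1 - x) / 2)
      - g x * (real b + 1 / 2 - x) - G x)"
    \<comment> \<open>At a clamped point either the kernel vanishes or \<open>g\<close> and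
      \<open>g'\<close> do, so \<open>M\<close> reduces to the trapezoidal term.\<close>
    have "M (c b) = - g (c b) / 2 - G (c b)"
      using c_cases[of b] ends by (auto simp: M_def)
    moreover have "M (c (Suc b)) = g (c (Suc b)) / 2 - G (c (Suc b))"
      using c_cases[of "Suc b"] ends by (auto simp: M_def)
    ultimately have M: "M (c (Suc b)) - M (c b)
        = (g (c b) + g (c (Suc b))) / 2 - (G (c (Suc b)) - G (c b))" by (simp add: field_simps)
    have *: "0 \<le> Nf x" "0 \<le> g'' x + Nf x" if "c b \<le> x" "x \<le> c (Suc b)" for x
      using Nf[of x] P[of x] that c_in[of b] c_in[of "Suc b"] by auto
    have "- (V (c (Suc b)) - V (c b)) / 8 \<le> M (c (Suc b)) - M (c b)"
      unfolding M_def by (rule trapezoid_remainder(1)[OF le G(1) dg dg' V]) (use * in auto)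
    moreover have "M (c (Suc b)) - M (c b) \<le> (g' (c (Suc b)) - g' (c b) + (V (c (Suc b)) - V (c b))) / 8"
      unfolding M_def by (rule trapezoid_remainder(2)[OF le G(1) dg dg' V]) (use * in auto)
    ultimately show ?thesis unfolding M by blast
  qed
  have tele: "(\<Sum>b<N. f (c (Suc b))) = (\<Sum>b<N. f (c b)) + (f A - f t)" for f :: "real \<Rightarrow> real"
    using sum_lessThan_telescope[of "\<lambda>b. f (c b)" N] by (simp add: c0 cN sum_subtractf)
  have sum_Suc: "(\<Sum>b<N. g (c (Suc b))) = (\<Sum>b=1..N. g (c b))"
    by (rule sum.reindex_bij_witness[of _ "\<lambda>b. b - 1" Suc]) auto
  have "(\<Sum>b<N. (g (c b) + g (c (Suc b))) / 2 - (G (c (Suc b)) - G (c b)))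
      = (\<Sum>b=1..N. g (c b)) - (G A - G t)"
    using tele[of g] tele[of G] ends sum_Suc
    by (simp add: sum_subtractf sum.distrib flip: sum_divide_distrib)
  moreover have "(\<Sum>b<N. - (V (c (Suc b)) - V (c b)) / 8) = - (V A - V t) / 8"
    using tele[of V] by (simp add: sum_subtractf flip: sum_divide_distrib)
  moreover have "(\<Sum>b<N. (g' (c (Suc b)) - g' (c b) + (V (c (Suc b)) - V (c b))) / 8) = (V A - V t) / 8"
    using tele[of V] tele[of g'] ends by (simp add: sum_subtractf sum.distrib flip: sum_divide_distrib)
  moreover have "(\<Sum>b<N. - (V (c (Suc b)) - V (c b)) / 8)
      \<le> (\<Sum>b<N. (g (c b) + g (c (Suc b))) / 2 - (G (c (Suc b)) - G (c b)))"
    by (rule sum_mono) (rule conjunct1[OF step])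
  moreover have "(\<Sum>b<N. (g (c b) + g (c (Suc b))) / 2 - (G (c (Suc b)) - G (c b)))
      \<le> (\<Sum>b<N. (g' (c (Suc b)) - g' (c b) + (V (c (Suc b)) - V (c b))) / 8)"
    by (rule sum_mono) (rule conjunct2[OF step])
  ultimately have "\<bar>(\<Sum>b=1..N. g (c b)) - (G A - G t)\<bar> \<le> (V A - V t) / 8"
    unfolding abs_le_iff by simp
  then show ?thesis using tA by (simp add: g_c G(2) V_diff tpow_eq_dpow)
qed

section \<open>Backward differences and the iterated sum\<close>

lemma sum_tpow_tpow:
  fixes t A :: real and N p q :: nat
  assumes t: "0 \<le> t" and A: "A \<le> real N"
  shows "\<bar>(\<Sum>b=1..N. tpow (p + 2) (real b - t) * tpow (q + 2) (A - real b))
            - tpow (p + q + 5) (A - t)\<bar>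
         \<le> (1 / real (p + 1) + 1 / real (q + 1)) / 8 * tpow (p + q + 3) (A - t)"
proof (cases "t \<le> A")
  case True
  then show ?thesis by (rule sum_tpow_tpow_pos[OF t A])
next
  case False
  then have "tpow (p + 2) (real b - t) * tpow (q + 2) (A - real b) = 0" for b
    by (cases "real b \<le> t") (auto simp: tpow_nonpos)
  then have "(\<Sum>b=1..N. tpow (p + 2) (real b - t) * tpow (q + 2) (A - real b)) = 0"
    by (intro sum.neutral ballI)
  then show ?thesis using False by (simp add: tpow_nonpos)
qed

fun bdiff :: "nat \<Rightarrow> (real \<Rightarrow> real) \<Rightarrow> real \<Rightarrow> real" where
  "bdiff 0 f x = f x"
| "bdiff (Suc k) f x = bdiff k f x - bdiff k f (x - 1)"

lemma has_real_derivative_bdiff: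
  assumes "\<And>x. (f has_real_derivative f' x) (at x)"
  shows "(bdiff k f has_real_derivative bdiff k f' x) (at x)"
proof (induction k arbitrary: x)
  case 0
  have "bdiff 0 f = f" by (rule ext) simp
  then show ?case using assms by simp
next
  case (Suc k)
  have eq: "bdiff (Suc k) f = (\<lambda>x. bdiff k f x - bdiff k f (x - 1))" by (rule ext) simp
  have "((\<lambda>x. bdiff k f (x - 1)) has_real_derivative bdiff k f' (x - 1) * 1) (at x)"
    by (rule DERIV_chain2[OF Suc.IH]) (auto intro!: derivative_eq_intros)
  then show ?case unfolding eq by (auto intro!: DERIV_diff Suc.IH)
qed

lemma has_real_derivative_bdiff_tpow:
  "q > 0 \<Longrightarrow> (bdiff k (tpow (Suc q)) has_real_derivative bdiff k (tpow q) x) (at x)"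
  by (rule has_real_derivative_bdiff) (rule has_real_derivative_tpow)

lemma bdiff_eq_sum:
  "bdiff k f x = (\<Sum>j=0..k. (-1) ^ j * real (k choose j) * f (x - real j))"
proof (induction k arbitrary: x)
  case 0
  then show ?case by simp
next
  case (Suc k)
  define c where "c = (\<lambda>j. (-1) ^ j * f (x - real j))"
  have 1: "bdiff k f x = (\<Sum>j=0..Suc k. real (k choose j) * c j)"
    by (simp add: Suc.IH c_def binomial_eq_0 mult_ac)
  have "bdiff k f (x - 1) = - (\<Sum>j=0..k. real (k choose j) * c (Suc j))"
    by (simp add: Suc.IH c_def sum_negf[symmetric] algebra_simps)
  also have "\<dots> = - (\<Sum>j=Suc 0..Suc k. real (k choose (j - 1)) * c j)"
    by (subst sum.shift_bounds_cl_Suc_ivl) simp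
  finally have 2: "bdiff k f (x - 1) = - (\<Sum>j=Suc 0..Suc k. real (k choose (j - 1)) * c j)" .
  have "bdiff (Suc k) f x = c 0 + (\<Sum>j=Suc 0..Suc k. real (k choose j) * c j + real (k choose (j - 1)) * c j)"
    unfolding bdiff.simps 1 2 by (subst sum.atLeast_Suc_atMost) (auto simp: sum.distrib)
  also have "(\<Sum>j=Suc 0..Suc k. real (k choose j) * c j + real (k choose (j - 1)) * c j)
      = (\<Sum>j=Suc 0..Suc k. real (Suc k choose j) * c j)"
    by (intro sum.cong refl) (auto simp: gr0_conv_Suc Suc_le_eq algebra_simps)
  also have "c 0 + \<dots> = (\<Sum>j=0..Suc k. real (Suc k choose j) * c j)"
    by (subst sum.atLeast_Suc_atMost[of 0 "Suc k"]) auto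
  finally show ?case by (simp add: c_def mult_ac)
qed

text \<open>
  This is \<open>sum_tpow_tpow\<close> integrated over \<open>t\<close> from \<open>0\<close> to \<open>1\<close>, by \<open>abs_diff_le_of_deriv\<close>.
\<close>

lemma sum_increment_tpow:
  fixes A :: real
  assumes A: "A \<le> real N"
  shows "\<bar>(\<Sum>b=1..N. (tpow (p + 3) (real b) - tpow (p + 3) (real b - 1)) * tpow (q + 2) (A - real b))
            - (tpow (p + q + 6) A - tpow (p + q + 6) (A - 1))\<bar>
         \<le> (1 / real (p + 1) + 1 / real (q + 1)) / 8
            * (tpow (p + q + 4) A - tpow (p + q + 4) (A - 1))"
proof -
  define \<kappa> where "\<kappa> = (1 / real (p + 1) + 1 / real (q + 1)) / 8"
  define u where "u = (\<lambda>t. (\<Sum>b=1..N. tpow (p + 3) (real b - t) * tpow (q + 2) (A - real b))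
    - tpow (p + q + 6) (A - t))"
  define v where "v = (\<lambda>t. - \<kappa> * tpow (p + q + 4) (A - t))"
  have dt: "((\<lambda>t. tpow (Suc r) (x - t)) has_real_derivative - tpow r (x - t)) (at t)"
    if "r > 0" for r x t
  proof -
    have "((\<lambda>t. tpow (Suc r) (x - t)) has_real_derivative tpow r (x - t) * -1) (at t)"
      by (rule DERIV_chain2[OF has_real_derivative_tpow[OF that]]) (auto intro!: derivative_eq_intros)
    then show ?thesis by simp
  qed
  have S: "p + 3 = Suc (p + 2)" "p + q + 6 = Suc (p + q + 5)" "p + q + 4 = Suc (p + q + 3)" by simp_all
  have main: "\<bar>u 1 - u 0\<bar> \<le> v 1 - v 0"
  proof (rule abs_diff_le_of_deriv)
    fix t :: real assume t: "0 \<le> t"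
    show "(u has_real_derivative
        (\<Sum>b=1..N. - tpow (p + 2) (real b - t) * tpow (q + 2) (A - real b)) - - tpow (p + q + 5) (A - t)) (at t)"
      unfolding u_def S by (intro DERIV_diff DERIV_sum DERIV_cmult_right dt) simp_all
    show "(v has_real_derivative - \<kappa> * - tpow (p + q + 3) (A - t)) (at t)"
      unfolding v_def S by (intro DERIV_cmult dt) simp
    show "\<bar>(\<Sum>b=1..N. - tpow (p + 2) (real b - t) * tpow (q + 2) (A - real b)) - - tpow (p + q + 5) (A - t)\<bar>
        \<le> - \<kappa> * - tpow (p + q + 3) (A - t)"
      using sum_tpow_tpow[OF t A, of p q] by (simp add: \<kappa>_def sum_negf abs_minus_commute)
  qed simp
  have u_diff: "u 0 - u 1 = (\<Sum>b=1..N. (tpow (p + 3) (real b) - tpow (p + 3) (real b - 1)) * tpow (q + 2) (A - real b))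
            - (tpow (p + q + 6) A - tpow (p + q + 6) (A - 1))"
    by (simp add: u_def left_diff_distrib sum_subtractf)
  have v_diff: "v 1 - v 0 = \<kappa> * (tpow (p + q + 4) A - tpow (p + q + 4) (A - 1))"
    by (simp add: v_def algebra_simps)
  show ?thesis
    unfolding \<kappa>_def[symmetric] u_diff[symmetric] v_diff[symmetric]
    using main by (subst abs_minus_commute)
qed

text \<open>
  In the induction step, the estimate for \<open>k\<close> is integrated over the interval \<open>[A - 1, A]\<close>, which adds
  one backward difference and raises all exponents by one. The exponents \<open>q\<close> and \<open>D\<close> in the
  constant are those of the case \<open>k = 0\<close> throughout, so the constant does not deteriorate.
\<close>

lemma sum_increment_bdiff_tpow:
  fixes A :: real
  assumes A: "A \<le> real N" and D: "D \<ge> 3" and q: "q \<ge> 2"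
  shows "\<bar>(\<Sum>b=1..N. (tpow D (real b) - tpow D (real b - 1)) * bdiff k (tpow (q + k)) (A - real b))
            - bdiff (Suc k) (tpow (D + q + k + 1)) A\<bar>
         \<le> (1 / (real D - 2) + 1 / (real q - 1)) / 8 * bdiff (Suc k) (tpow (D + q + k - 1)) A"
  using A
proof (induction k arbitrary: A)
  case 0
  obtain p where p: "D = p + 3" using D by (metis add.commute le_iff_add)
  obtain r where r: "q = r + 2" using q by (metis add.commute le_iff_add)
  have e: "D + q + 0 + 1 = p + r + 6" "D + q + 0 - 1 = p + r + 4" "real D - 2 = real (p + 1)"
    "real q - 1 = real (r + 1)" using p r by simp_all
  show ?case unfolding e using sum_increment_tpow[OF 0, of p r] by (simp add: p r)
next
  case (Suc k)
  define w where "w = (\<lambda>b. tpow D (real b) - tpow D (real b - 1))"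
  define \<kappa> where "\<kappa> = (1 / (real D - 2) + 1 / (real q - 1)) / 8"
  define u where "u = (\<lambda>x. (\<Sum>b=1..N. w b * bdiff k (tpow (q + Suc k)) (x - real b))
    - bdiff (Suc k) (tpow (D + q + Suc k + 1)) x)"
  define v where "v = (\<lambda>x. \<kappa> * bdiff (Suc k) (tpow (D + q + Suc k - 1)) x)"
  have S: "q + Suc k = Suc (q + k)" "D + q + Suc k + 1 = Suc (D + q + k + 1)"
    "D + q + Suc k - 1 = Suc (D + q + k - 1)" using D by simp_all
  have "\<bar>u A - u (A - 1)\<bar> \<le> v A - v (A - 1)"
  proof (rule abs_diff_le_of_deriv)
    fix x assume x: "A - 1 \<le> x" "x \<le> A"
    have db: "((\<lambda>x. bdiff k (tpow (Suc (q + k))) (x - real b)) has_real_derivative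
        bdiff k (tpow (q + k)) (x - real b)) (at x)" for b
    proof -
      have "((\<lambda>x. bdiff k (tpow (Suc (q + k))) (x - real b)) has_real_derivative
          bdiff k (tpow (q + k)) (x - real b) * 1) (at x)"
        by (rule DERIV_chain2[OF has_real_derivative_bdiff_tpow]) (use q in \<open>auto intro!: derivative_eq_intros\<close>)
      then show ?thesis by simp
    qed
    show "(u has_real_derivative (\<Sum>b=1..N. w b * bdiff k (tpow (q + k)) (x - real b))
        - bdiff (Suc k) (tpow (D + q + k + 1)) x) (at x)"
      unfolding u_def S by (intro DERIV_diff DERIV_sum DERIV_cmult db has_real_derivative_bdiff_tpow) simp
    show "(v has_real_derivative \<kappa> * bdiff (Suc k) (tpow (D + q + k - 1)) x) (at x)"
      unfolding v_def S by (intro DERIV_cmult has_real_derivative_bdiff_tpow) (use D in simp)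
    show "\<bar>(\<Sum>b=1..N. w b * bdiff k (tpow (q + k)) (x - real b))
        - bdiff (Suc k) (tpow (D + q + k + 1)) x\<bar> \<le> \<kappa> * bdiff (Suc k) (tpow (D + q + k - 1)) x"
      unfolding w_def \<kappa>_def using Suc.IH[of x] x Suc.prems by simp
  qed simp
  moreover have "u A - u (A - 1) = (\<Sum>b=1..N. w b * bdiff (Suc k) (tpow (q + Suc k)) (A - real b))
      - bdiff (Suc (Suc k)) (tpow (D + q + Suc k + 1)) A"
  proof -
    have sh: "A - 1 - real b = A - real b - 1" for b by simp
    show ?thesis
      unfolding u_def bdiff.simps(2)[of "Suc k"] sh bdiff.simps(2)[of k "tpow (q + Suc k)"]
        right_diff_distrib sum_subtractf by simp
  qed
  moreover have "v A - v (A - 1) = \<kappa> * bdiff (Suc (Suc k)) (tpow (D + q + Suc k - 1)) A"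
    unfolding v_def bdiff.simps(2)[of "Suc k"] by (simp only: right_diff_distrib)
  ultimately show ?case unfolding w_def \<kappa>_def by simp
qed

text \<open>
  Without differences, the claim follows from \<open>(r + 2) * (r + 1) \<le> R\<^sup>2\<close> and \<open>L \<le> A\<close>. Each backward difference
  integrates over an interval of length one to the left, which is why \<open>A - k\<close> is compared with \<open>L\<close>.
\<close>

lemma bdiff_tpow_ratio:
  assumes L: "L > 0" and r: "r > 0" and R: "real (r + 2) \<le> R" and A: "L \<le> A - real k"
  shows "\<bar>L\<^sup>2 * bdiff k (tpow (r + k)) A\<bar> \<le> R\<^sup>2 * bdiff k (tpow (r + 2 + k)) A"
  using A
proof (induction k arbitrary: A)
  case 0
  then have A: "L \<le> A" by simp
  have "L\<^sup>2 * (A ^ r / fact r) = L\<^sup>2 * (real (r + 2) * real (r + 1)) * (A ^ r / fact (r + 2))"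
    by (simp add: divide_simps)
  also have "\<dots> \<le> A\<^sup>2 * R\<^sup>2 * (A ^ r / fact (r + 2))"
  proof (intro mult_right_mono mult_mono power_mono)
    have "real (r + 2) * real (r + 1) \<le> R * R"
      using R by (intro mult_mono) auto
    then show "real (r + 2) * real (r + 1) \<le> R\<^sup>2" by (simp add: power2_eq_square)
  qed (use A L in auto)
  finally have "L\<^sup>2 * tpow r A \<le> R\<^sup>2 * tpow (r + 2) A"
    using A L by (simp add: tpow_eq_dpow dpow_def power2_eq_square mult_ac)
  then show ?case using tpow_nonneg[of r A] by simp
next
  case (Suc k)
  define u where "u = (\<lambda>x. L\<^sup>2 * bdiff k (tpow (r + Suc k)) x)"
  define v where "v = (\<lambda>x. R\<^sup>2 * bdiff k (tpow (r + 2 + Suc k)) x)"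
  have "\<bar>u A - u (A - 1)\<bar> \<le> v A - v (A - 1)"
  proof (rule abs_diff_le_of_deriv)
    fix x assume x: "A - 1 \<le> x" "x \<le> A"
    show "(u has_real_derivative L\<^sup>2 * bdiff k (tpow (r + k)) x) (at x)"
      unfolding u_def add_Suc_right by (intro DERIV_cmult has_real_derivative_bdiff_tpow) (use r in simp)
    show "(v has_real_derivative R\<^sup>2 * bdiff k (tpow (r + 2 + k)) x) (at x)"
      unfolding v_def add_Suc_right by (intro DERIV_cmult has_real_derivative_bdiff_tpow) (use r in simp)
    show "\<bar>L\<^sup>2 * bdiff k (tpow (r + k)) x\<bar> \<le> R\<^sup>2 * bdiff k (tpow (r + 2 + k)) x"
      using x Suc.prems by (intro Suc.IH) simp
  qed simp
  then show ?case by (simp add: u_def v_def right_diff_distrib)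
qed

lemma sum_binomial_shift:
  fixes x :: "nat \<Rightarrow> real"
  shows "(\<Sum>i=1..k. real (k choose i) * (x i + x (Suc i))) + x 1
    = (\<Sum>i=1..Suc k. real (Suc k choose i) * x i)"
proof -
  have "(\<Sum>i=1..Suc k. real (Suc k choose i) * x i)
      = (\<Sum>i=1..Suc k. real (k choose i) * x i + real (k choose (i - 1)) * x i)"
    by (intro sum.cong refl) (auto simp: gr0_conv_Suc Suc_le_eq algebra_simps)
  also have "\<dots> = (\<Sum>i=1..Suc k. real (k choose i) * x i) + (\<Sum>i=Suc 0..Suc k. real (k choose (i - 1)) * x i)"
    by (simp only: sum.distrib One_nat_def)
  also have "(\<Sum>i=1..Suc k. real (k choose i) * x i) = (\<Sum>i=1..k. real (k choose i) * x i)"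
    by (simp add: binomial_eq_0)
  also have "(\<Sum>i=Suc 0..Suc k. real (k choose (i - 1)) * x i) = (\<Sum>i=0..k. real (k choose i) * x (Suc i))"
    by (subst sum.shift_bounds_cl_Suc_ivl) simp
  also have "\<dots> = x 1 + (\<Sum>i=1..k. real (k choose i) * x (Suc i))"
    by (subst sum.atLeast_Suc_atMost) auto
  finally show ?thesis by (simp add: sum.distrib algebra_simps)
qed

text \<open>
  With \<open>\<epsilon> = 1 / (4 * (d - 2))\<close>, let \<open>\<psi> i\<close> be the backward difference of order \<open>k\<close> with its exponent lowered by \<open>2 * i\<close>,
  and \<open>\<psi>'\<close> the same for \<open>k + 1\<close>. One more summation sends \<open>\<psi> i\<close> to \<open>\<psi>' i\<close> up to an error of at most
  \<open>\<epsilon> * \<psi>' (i + 1)\<close>. So the step acts on the coefficients like multiplication by \<open>1 + \<epsilon> * X\<close>, where \<open>X\<close>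
  lowers the exponent by \<open>2\<close>, and \<open>k\<close> steps give the coefficients of \<open>(1 + \<epsilon> * X) ^ k\<close>; the
  main term is the coefficient for \<open>i = 0\<close>. The exponents never drop below \<open>d\<close>, since every summation
  adds at least \<open>d\<close> and an error term removes only \<open>2\<close>.
\<close>

lemma iterated_sum_error:
  fixes F :: "nat \<Rightarrow> nat \<Rightarrow> real" and E :: "nat \<Rightarrow> nat" and d :: nat
  assumes d: "d \<ge> 3" and E: "\<And>i. i \<le> k \<Longrightarrow> E i \<ge> d"
    and F0: "\<And>a. F 0 a = tpow (E 0) (real a)"
    and FS: "\<And>j a. j < k \<Longrightarrow> F (Suc j) a
      = (\<Sum>b=1..a. (tpow (E (Suc j)) (real b) - tpow (E (Suc j)) (real b - 1)) * F j (a - b))"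
  shows "\<bar>F k a - bdiff k (tpow ((\<Sum>i\<le>k. E i) + k)) (real a)\<bar>
    \<le> (\<Sum>i=1..k. real (k choose i) * ((1 / (4 * (real d - 2))) ^ i
          * bdiff k (tpow ((\<Sum>i\<le>k. E i) + k - 2 * i)) (real a)))"
  using E FS
proof (induction k arbitrary: a)
  case 0
  then show ?case by (simp add: F0)
next
  case (Suc k)
  define \<epsilon> where "\<epsilon> = 1 / (4 * (real d - 2))"
  define s where "s = (\<Sum>i\<le>k. E i)"
  define D where "D = E (Suc k)"
  define w where "w = (\<lambda>b. tpow D (real b) - tpow D (real b - 1))"
  define \<psi> where "\<psi> = (\<lambda>i. bdiff k (tpow (s + k - 2 * i)))"
  define \<psi>' where "\<psi>' = (\<lambda>i. bdiff (Suc k) (tpow (s + D + Suc k - 2 * i)))"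
  have \<epsilon>: "\<epsilon> > 0" using d by (simp add: \<epsilon>_def)
  have D: "D \<ge> d" using Suc.prems(1)[of "Suc k"] by (simp add: D_def)
  have "d * Suc k \<le> s"
  proof -
    have "(\<Sum>i\<le>k. d) \<le> s" unfolding s_def by (rule sum_mono) (use Suc.prems(1) in auto)
    then show ?thesis by (simp add: algebra_simps)
  qed
  moreover have "3 * k \<le> d * k" using d by (rule mult_right_mono) simp
  ultimately have s: "d + 3 * k \<le> s" unfolding mult_Suc_right by linarith
  have w: "w b \<ge> 0" if "b \<ge> 1" for b
    using that by (auto simp: w_def tpow_def dpow_def intro!: divide_right_mono power_mono)
  have W: "\<bar>(\<Sum>b=1..a. w b * \<psi> i (real a - real b)) - \<psi>' i (real a)\<bar> \<le> \<epsilon> * \<psi>' (Suc i) (real a)"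
    if "i \<le> k" for i
  proof -
    \<comment> \<open>Every term \<open>\<psi> i\<close> is the backward difference of order
      \<open>k\<close> of \<open>tpow (q + k)\<close>, so this is the exponent for the one-step
      estimate.\<close>
    define q where "q = s - 2 * i"
    define \<kappa> where "\<kappa> = (1 / (real D - 2) + 1 / (real q - 1)) / 8"
    have q: "q \<ge> d" "2 * i \<le> s" using s that by (auto simp: q_def)
    have e: "q + k = s + k - 2 * i" "D + q + k + 1 = s + D + Suc k - 2 * i"
      "D + q + k - 1 = s + D + Suc k - 2 * Suc i"
      using q(2) D d by (auto simp: q_def)
    have *: "\<bar>(\<Sum>b=1..a. w b * \<psi> i (real a - real b)) - \<psi>' i (real a)\<bar> \<le> \<kappa> * \<psi>' (Suc i) (real a)"
      using sum_increment_bdiff_tpow[of "real a" a D q k] D q d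
      unfolding e w_def \<psi>_def \<psi>'_def \<kappa>_def by simp
    have \<kappa>: "\<kappa> > 0" "\<kappa> \<le> \<epsilon>"
    proof -
      define x where "x = 1 / (real D - 2)"
      define y where "y = 1 / (real q - 1)"
      define z where "z = 1 / (real d - 2)"
      have "x \<le> z" "y \<le> z" "x > 0" "y > 0"
        using D q d by (auto simp: x_def y_def z_def intro!: divide_left_mono)
      moreover have "\<kappa> = (x + y) / 8" "\<epsilon> = z / 4"
        by (simp_all add: \<kappa>_def \<epsilon>_def x_def y_def z_def)
      ultimately show "\<kappa> > 0" "\<kappa> \<le> \<epsilon>" by simp_all
    qed
    from * have "0 \<le> \<kappa> * \<psi>' (Suc i) (real a)" by linarith
    then have "0 \<le> \<psi>' (Suc i) (real a)" using \<kappa>(1) by (simp add: zero_le_mult_iff)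
    then have "\<kappa> * \<psi>' (Suc i) (real a) \<le> \<epsilon> * \<psi>' (Suc i) (real a)"
      using \<kappa>(2) by (rule mult_right_mono[rotated])
    then show ?thesis using * by linarith
  qed
  have IH: "\<bar>F k c - \<psi> 0 (real c)\<bar> \<le> (\<Sum>i=1..k. real (k choose i) * (\<epsilon> ^ i * \<psi> i (real c)))" for c
    using Suc.IH[of c] Suc.prems unfolding \<epsilon>_def \<psi>_def s_def by simp
  have F: "F (Suc k) a = (\<Sum>b=1..a. w b * F k (a - b))"
    using Suc.prems(2)[of k a] by (simp add: w_def D_def)
  have "\<bar>F (Suc k) a - (\<Sum>b=1..a. w b * \<psi> 0 (real a - real b))\<bar>
      = \<bar>\<Sum>b=1..a. w b * (F k (a - b) - \<psi> 0 (real (a - b)))\<bar>"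
  proof -
    have "(\<Sum>b=1..a. w b * F k (a - b)) - (\<Sum>b=1..a. w b * \<psi> 0 (real a - real b))
        = (\<Sum>b=1..a. w b * (F k (a - b) - \<psi> 0 (real (a - b))))"
      unfolding sum_subtractf[symmetric]
      by (intro sum.cong refl) (simp add: of_nat_diff right_diff_distrib)
    then show ?thesis unfolding F by simp
  qed
  also have "\<dots> \<le> (\<Sum>b=1..a. \<bar>w b * (F k (a - b) - \<psi> 0 (real (a - b)))\<bar>)" by (rule sum_abs)
  also have "\<dots> \<le> (\<Sum>b=1..a. w b * (\<Sum>i=1..k. real (k choose i) * (\<epsilon> ^ i * \<psi> i (real a - real b))))"
  proof (rule sum_mono)
    fix b assume b: "b \<in> {1..a}"
    then show "\<bar>w b * (F k (a - b) - \<psi> 0 (real (a - b)))\<bar>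
        \<le> w b * (\<Sum>i=1..k. real (k choose i) * (\<epsilon> ^ i * \<psi> i (real a - real b)))"
      using IH[of "a - b"] w[of b] by (auto simp: abs_mult of_nat_diff intro!: mult_left_mono)
  qed
  also have "\<dots> = (\<Sum>i=1..k. real (k choose i) * (\<epsilon> ^ i * (\<Sum>b=1..a. w b * \<psi> i (real a - real b))))"
    unfolding sum_distrib_left by (subst sum.swap) (simp add: mult_ac)
  also have "\<dots> \<le> (\<Sum>i=1..k. real (k choose i) * (\<epsilon> ^ i * \<psi>' i (real a) + \<epsilon> ^ Suc i * \<psi>' (Suc i) (real a)))"
  proof (rule sum_mono)
    fix i assume i: "i \<in> {1..k}"
    have "(\<Sum>b=1..a. w b * \<psi> i (real a - real b)) \<le> \<psi>' i (real a) + \<epsilon> * \<psi>' (Suc i) (real a)"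
      using W[of i] i by auto
    then have "\<epsilon> ^ i * (\<Sum>b=1..a. w b * \<psi> i (real a - real b)) \<le> \<epsilon> ^ i * (\<psi>' i (real a) + \<epsilon> * \<psi>' (Suc i) (real a))"
      using \<epsilon> by (intro mult_left_mono) auto
    also have "\<dots> = \<epsilon> ^ i * \<psi>' i (real a) + \<epsilon> ^ Suc i * \<psi>' (Suc i) (real a)"
      by (simp add: algebra_simps)
    finally show "real (k choose i) * (\<epsilon> ^ i * (\<Sum>b=1..a. w b * \<psi> i (real a - real b)))
        \<le> real (k choose i) * (\<epsilon> ^ i * \<psi>' i (real a) + \<epsilon> ^ Suc i * \<psi>' (Suc i) (real a))"
      by (rule mult_left_mono) simp
  qed
  finally have 1: "\<bar>F (Suc k) a - (\<Sum>b=1..a. w b * \<psi> 0 (real a - real b))\<bar>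
    \<le> (\<Sum>i=1..k. real (k choose i) * (\<epsilon> ^ i * \<psi>' i (real a) + \<epsilon> ^ Suc i * \<psi>' (Suc i) (real a)))" .
  have 2: "\<bar>(\<Sum>b=1..a. w b * \<psi> 0 (real a - real b)) - \<psi>' 0 (real a)\<bar> \<le> \<epsilon> ^ 1 * \<psi>' 1 (real a)"
    using W[of 0] by simp
  have "\<bar>F (Suc k) a - \<psi>' 0 (real a)\<bar>
      \<le> (\<Sum>i=1..k. real (k choose i) * (\<epsilon> ^ i * \<psi>' i (real a) + \<epsilon> ^ Suc i * \<psi>' (Suc i) (real a)))
        + \<epsilon> ^ 1 * \<psi>' 1 (real a)"
    using 1 2 by linarith
  also have "\<dots> = (\<Sum>i=1..Suc k. real (Suc k choose i) * (\<epsilon> ^ i * \<psi>' i (real a)))"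
    by (rule sum_binomial_shift)
  finally show ?case unfolding \<psi>'_def \<epsilon>_def s_def D_def by simp
qed

text \<open>
  Lowering the exponent by \<open>2 * i\<close> costs at most a factor \<open>\<rho> ^ i\<close> with \<open>\<rho> = n\<^sup>2 / (a - k)\<^sup>2\<close>, so the
  accumulated error is at most the main term times
  \<open>\<Sum>i=1..k. (k choose i) * (\<epsilon> * \<rho>) ^ i = (1 + \<epsilon> * \<rho>) ^ k - 1\<close>.
\<close>

lemma iterated_sum_relative_error:
  fixes F :: "nat \<Rightarrow> nat \<Rightarrow> real" and E :: "nat \<Rightarrow> nat" and d k a :: nat
  assumes d: "d \<ge> 3" and E: "\<And>i. i \<le> k \<Longrightarrow> E i \<ge> d"
    and F0: "\<And>a. F 0 a = tpow (E 0) (real a)"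
    and FS: "\<And>j a. j < k \<Longrightarrow> F (Suc j) a
      = (\<Sum>b=1..a. (tpow (E (Suc j)) (real b) - tpow (E (Suc j)) (real b - 1)) * F j (a - b))"
    and n: "n = (\<Sum>i\<le>k. E i)" and a: "k < a"
  shows "\<bar>F k a - bdiff k (tpow (n + k)) (real a)\<bar>
    \<le> ((1 + (real n)\<^sup>2 / (4 * (real d - 2) * (real a - real k)\<^sup>2)) ^ k - 1)
      * bdiff k (tpow (n + k)) (real a)"
proof -
  define \<epsilon> where "\<epsilon> = 1 / (4 * (real d - 2))"
  define L where "L = real a - real k"
  define \<rho> where "\<rho> = (real n)\<^sup>2 / L\<^sup>2"
  define \<psi> where "\<psi> = (\<lambda>i. bdiff k (tpow (n + k - 2 * i)) (real a))"
  have L: "L > 0" using a by (simp add: L_def)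
  have \<epsilon>: "\<epsilon> > 0" using d by (simp add: \<epsilon>_def)
  have "(\<Sum>i\<le>k. 3) \<le> n" unfolding n
    by (rule sum_mono) (use E d in \<open>meson atMost_iff le_trans\<close>)
  then have n3: "3 * k + 3 \<le> n" by simp
  have ratio: "\<psi> i \<le> \<rho> ^ i * \<psi> 0" if "i \<le> k" for i
    using that
  proof (induction i)
    case (Suc i)
    define r where "r = n - 2 * Suc i"
    have r: "r > 0" "r + 2 \<le> n" "r + k = n + k - 2 * Suc i" "r + 2 + k = n + k - 2 * i"
      using n3 Suc.prems by (auto simp: r_def)
    have "\<bar>L\<^sup>2 * bdiff k (tpow (r + k)) (real a)\<bar> \<le> (real n)\<^sup>2 * bdiff k (tpow (r + 2 + k)) (real a)"
      using r by (intro bdiff_tpow_ratio L) (auto simp: L_def)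
    then have "L\<^sup>2 * \<psi> (Suc i) \<le> (real n)\<^sup>2 * \<psi> i" unfolding r \<psi>_def by linarith
    then have "\<psi> (Suc i) \<le> \<rho> * \<psi> i"
      using L by (simp add: \<rho>_def field_simps)
    also have "\<dots> \<le> \<rho> * (\<rho> ^ i * \<psi> 0)"
      using Suc by (intro mult_left_mono) (auto simp: \<rho>_def)
    finally show ?case by (simp add: mult_ac)
  qed simp
  have "\<bar>F k a - \<psi> 0\<bar> \<le> (\<Sum>i=1..k. real (k choose i) * (\<epsilon> ^ i * \<psi> i))"
    using iterated_sum_error[where F = F and E = E and k = k and a = a, OF d E F0 FS] unfolding n[symmetric] \<epsilon>_def \<psi>_def
    by (simp only: mult_0_right diff_zero)
  also have "\<dots> \<le> (\<Sum>i=1..k. real (k choose i) * (\<epsilon> ^ i * (\<rho> ^ i * \<psi> 0)))"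
    using ratio \<epsilon> by (intro sum_mono mult_left_mono) auto
  also have "\<dots> = (\<Sum>i=1..k. real (k choose i) * (\<epsilon> * \<rho>) ^ i) * \<psi> 0"
    unfolding sum_distrib_right by (intro sum.cong refl) (simp add: power_mult_distrib mult_ac)
  also have "(\<Sum>i=1..k. real (k choose i) * (\<epsilon> * \<rho>) ^ i) = (1 + \<epsilon> * \<rho>) ^ k - 1"
    using binomial_ring[of "\<epsilon> * \<rho>" 1 k]
    by (simp add: add.commute atMost_atLeast0 sum.atLeast_Suc_atMost[of 0 k])
  also have "\<epsilon> * \<rho> = (real n)\<^sup>2 / (4 * (real d - 2) * L\<^sup>2)"
    by (simp add: \<epsilon>_def \<rho>_def)
  finally show ?thesis by (simp add: \<psi>_def L_def)
qed

section \<open>A recurrence for the smallest probability\<close>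

text \<open>
  The number of strict labellings of the first \<open>k + 1\<close> types, divided by the factorials that
  turn powers into divided powers. The index starts at \<open>0\<close> for a single type, where no summation
  has taken place.
\<close>

definition label_weight :: "(nat \<Rightarrow> nat) \<Rightarrow> nat \<Rightarrow> nat \<Rightarrow> real" where
  "label_weight D k a = real (card (strict_labels a (deck (Suc k) D))) / (\<Prod>i=1..Suc k. fact (D i))"

lemma label_weight_0: "label_weight D 0 a = tpow (D 1) (real a)"
proof -
  have "deck (Suc 0) D = replicate (D 1) 1" by (simp add: deck_def)
  then show ?thesis
    by (simp add: label_weight_def strict_labels_replicate card_lists_length_eq tpow_eq_dpow dpow_def)
qed

lemma label_weight_Suc:
  assumes "D (Suc (Suc k)) > 0"
  shows "label_weight D (Suc k) a = (\<Sum>b=1..a.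
    (tpow (D (Suc (Suc k))) (real b) - tpow (D (Suc (Suc k))) (real b - 1)) * label_weight D k (a - b))"
proof -
  let ?r = "D (Suc (Suc k))" and ?w = "deck (Suc k) D"
  let ?P = "\<Prod>i=1..Suc k. fact (D i) :: real"
  have lt: "y < Suc (Suc k)" if "y \<in> set ?w" for y
    using that deck_in_configurations[of "Suc k" D] by (auto simp: configurations_def)
  have "card (strict_labels a (?w @ replicate ?r (Suc (Suc k))))
      = (\<Sum>b=1..a. (b ^ ?r - (b - 1) ^ ?r) * card (strict_labels (a - b) ?w))"
    by (rule card_strict_labels_append_replicate[OF lt assms])
  then have card: "card (strict_labels a (deck (Suc (Suc k)) D))
      = (\<Sum>b=1..a. (b ^ ?r - (b - 1) ^ ?r) * card (strict_labels (a - b) ?w))"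
    by (simp only: deck_Suc[of "Suc k"])
  have P: "(\<Prod>i=1..Suc (Suc k). fact (D i) :: real) = fact ?r * ?P" by simp
  have term_eq: "real ((b ^ ?r - (b - 1) ^ ?r) * c) / (fact ?r * ?P)
      = (tpow ?r (real b) - tpow ?r (real b - 1)) * (real c / ?P)" if b: "b \<in> {1..a}" for b c
  proof -
    have "(b - 1) ^ ?r \<le> b ^ ?r" by (rule power_mono) simp_all
    then have "real (b ^ ?r - (b - 1) ^ ?r) = real b ^ ?r - (real b - 1) ^ ?r"
      using b by (simp add: of_nat_diff)
    also have "\<dots> = fact ?r * (tpow ?r (real b) - tpow ?r (real b - 1))"
      using b by (simp add: tpow_eq_dpow dpow_def right_diff_distrib)
    finally show ?thesis by simp
  qed
  show ?thesis
    unfolding label_weight_def card P of_nat_sum sum_divide_distrib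
    by (intro sum.cong refl term_eq)
qed

text \<open>
  \<open>k + 1\<close> types need \<open>k + 1\<close> different labels.
\<close>

lemma label_weight_eq_0:
  assumes "\<And>i. i \<le> k \<Longrightarrow> D (Suc i) > 0" "a \<le> k"
  shows "label_weight D k a = 0"
  using assms
proof (induction k arbitrary: a)
  case 0
  then show ?case using "0.prems"(1)[of 0] by (simp add: label_weight_0 tpow_nonpos)
next
  case (Suc k)
  then show ?case by (subst label_weight_Suc) (auto intro!: sum.neutral)
qed

lemma separation_distance_eq_label_weight:
  assumes "a \<ge> 1" and n: "n = (\<Sum>i=1..Suc k. D i)"
  shows "separation_distance a (Suc k) D = 1 - fact n / real a ^ n * label_weight D k a"
  unfolding separation_distance_eq[OF assms(1)] label_weight_def uniform_prob_def n[symmetric]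
  by simp

section \<open>The separation distance\<close>

text \<open>
  For \<open>k < a\<close> all arguments \<open>a - j\<close> with \<open>j \<le> k\<close> are positive, so the truncation is void and the
  backward difference is an alternating sum of ordinary powers.
\<close>

lemma main_term_eq_bdiff:
  assumes a: "k < a"
  shows "real a ^ k / (\<Prod>i=1..k. real (n + i)) *
      (\<Sum>j=0..k. (-1) ^ j * real (k choose j) * (1 - real j / real a) ^ (n + k))
    = fact n / real a ^ n * bdiff k (tpow (n + k)) (real a)"
proof -
  have P: "fact n * (\<Prod>i=1..k. real (n + i)) = fact (n + k)"
  proof (induction k)
    case (Suc k)
    have "fact n * (\<Prod>i=1..Suc k. real (n + i)) = (fact n * (\<Prod>i=1..k. real (n + i))) * real (n + Suc k)"
      by simp
    also have "\<dots> = fact (n + Suc k)" unfolding Suc.IH by (simp add: mult.commute)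
    finally show ?case .
  qed simp
  then have prod_eq: "(\<Prod>i=1..k. real (n + i)) = fact (n + k) / fact n"
    by (simp add: field_simps)
  have "bdiff k (tpow (n + k)) (real a)
      = (\<Sum>j=0..k. (-1) ^ j * real (k choose j) * ((real a - real j) ^ (n + k) / fact (n + k)))"
    unfolding bdiff_eq_sum using a by (intro sum.cong refl) (simp add: tpow_eq_dpow dpow_def)
  also have "\<dots> = (\<Sum>j=0..k. real a ^ (n + k) / fact (n + k)
      * ((-1) ^ j * real (k choose j) * (1 - real j / real a) ^ (n + k)))"
  proof (intro sum.cong refl)
    fix j
    have "real a - real j = real a * (1 - real j / real a)" using a by (simp add: field_simps)
    then have "(real a - real j) ^ (n + k) = real a ^ (n + k) * (1 - real j / real a) ^ (n + k)"
      by (metis power_mult_distrib)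
    then show "(-1) ^ j * real (k choose j) * ((real a - real j) ^ (n + k) / fact (n + k))
        = real a ^ (n + k) / fact (n + k) * ((-1) ^ j * real (k choose j) * (1 - real j / real a) ^ (n + k))"
      by (simp only:) simp
  qed
  also have "\<dots> = real a ^ (n + k) / fact (n + k)
      * (\<Sum>j=0..k. (-1) ^ j * real (k choose j) * (1 - real j / real a) ^ (n + k))"
    by (rule sum_distrib_left[symmetric])
  finally show ?thesis
    unfolding prod_eq using a by (simp only:) (simp add: power_add)
qed

theorem theorem4p6:
  fixes m a d n :: nat and D :: "nat \<Rightarrow> nat"
  assumes "m \<ge> 1" and "a \<ge> 1" and "d \<ge> 3"
    and "\<And>i. 1 \<le> i \<Longrightarrow> i \<le> m \<Longrightarrow> D i \<ge> d"
    and "n = (\<Sum>i=1..m. D i)"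
    and "a \<noteq> m - 1"
  shows "\<exists>\<eta>::real.
    separation_distance a m D =
      1 - (1 + \<eta>) * (real a ^ (m - 1) / (\<Prod>k=1..m - 1. real (n + k)))
        * (\<Sum>j=0..m - 1. (- 1) ^ j * real (m - 1 choose j)
            * (1 - real j / real a) ^ (n + m - 1))
    \<and> \<bar>\<eta>\<bar> \<le> (1 + (real n)^2 / (3 * (real d - 2) * (real a - real m + 1)^2)) ^ (m - 1) - 1"
proof -
  obtain k where m: "m = Suc k" using assms(1) by (cases m) auto
  define X where "X = (real n)\<^sup>2 / (3 * (real d - 2) * (real a - real k)\<^sup>2)"
  define S where "S = real a ^ k / (\<Prod>i=1..k. real (n + i))
    * (\<Sum>j=0..k. (-1) ^ j * real (k choose j) * (1 - real j / real a) ^ (n + k))"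
  have D: "D (Suc i) \<ge> d" if "i \<le> k" for i using assms(4)[of "Suc i"] that m by simp
  have n: "n = (\<Sum>i\<le>k. D (Suc i))"
    unfolding assms(5) m atMost_atLeast0 One_nat_def by (rule sum.shift_bounds_cl_Suc_ivl)
  have sep: "separation_distance a (Suc k) D = 1 - fact n / real a ^ n * label_weight D k a"
    by (rule separation_distance_eq_label_weight) (use assms(2,5) m in auto)
  have X0: "X \<ge> 0" using assms(3) by (simp add: X_def)
  have "\<exists>\<eta>. fact n / real a ^ n * label_weight D k a = (1 + \<eta>) * S \<and> \<bar>\<eta>\<bar> \<le> (1 + X) ^ k - 1"
  proof (cases "k < a")
    case False
    then have ak: "a < k" using assms(6) m by simp
    have "label_weight D k a = 0"
      by (rule label_weight_eq_0) (use D assms(3) ak in \<open>force+\<close>)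
    moreover have "1 \<le> (1 + X) ^ k - 1"
    proof -
      have "(\<Sum>i\<le>k. d) \<le> n" unfolding n by (rule sum_mono) (use D in auto)
      then have "real d * real (Suc k) \<le> real n" unfolding of_nat_mult[symmetric] of_nat_le_iff by (simp add: mult.commute)
      then have "real d * (real k - real a) \<le> real n"
        by (rule order_trans[rotated]) (intro mult_left_mono, simp_all)
      then have "(real d * (real k - real a))\<^sup>2 \<le> (real n)\<^sup>2"
        using ak by (intro power_mono) simp_all
      \<comment> \<open>\<open>d\<^sup>2 - 3 * d + 6\<close> has negative discriminant; completing
        the square shows it is positive.\<close>
      moreover have "3 * (real d - 2) \<le> (real d)\<^sup>2"
        using zero_le_power2[of "real d - 3 / 2"] by (simp add: power2_eq_square algebra_simps)
      then have "3 * (real d - 2) * (real k - real a)\<^sup>2 \<le> (real d)\<^sup>2 * (real k - real a)\<^sup>2"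
        by (rule mult_right_mono) simp
      ultimately have "3 * (real d - 2) * (real a - real k)\<^sup>2 \<le> (real n)\<^sup>2"
        by (simp add: power_mult_distrib power2_commute)
      then have "1 \<le> X" using ak assms(3) by (simp add: X_def)
      moreover have "1 + X \<le> (1 + X) ^ k" using X0 ak by (intro self_le_power) simp_all
      ultimately show ?thesis by linarith
    qed
    ultimately show ?thesis by (intro exI[of _ "-1"]) simp
  next
    case True
    define \<psi> where "\<psi> = bdiff k (tpow (n + k)) (real a)"
    define Y where "Y = (real n)\<^sup>2 / (4 * (real d - 2) * (real a - real k)\<^sup>2)"
    have S: "S = fact n / real a ^ n * \<psi>"
      unfolding S_def \<psi>_def by (rule main_term_eq_bdiff[OF True])
    have "\<bar>label_weight D k a - \<psi>\<bar> \<le> ((1 + Y) ^ k - 1) * \<psi>"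
      unfolding \<psi>_def Y_def
    proof (rule iterated_sum_relative_error[where E = "\<lambda>i. D (Suc i)"])
      show "label_weight D (Suc j) b = (\<Sum>c=1..b. (tpow (D (Suc (Suc j))) (real c)
          - tpow (D (Suc (Suc j))) (real c - 1)) * label_weight D j (b - c))" if "j < k" for j b
        using D[of "Suc j"] that assms(3) by (intro label_weight_Suc) simp
    qed (use D n True assms(3) in \<open>simp_all add: label_weight_0\<close>)
    also have "\<dots> \<le> ((1 + X) ^ k - 1) * \<bar>\<psi>\<bar>"
    proof -
      have Y: "0 \<le> Y" "Y \<le> X"
        using True assms(3) unfolding X_def Y_def by (auto intro!: divide_left_mono)
      then have "(1 + Y) ^ k \<le> (1 + X) ^ k" by (intro power_mono) simp_all
      moreover have "1 \<le> (1 + Y) ^ k" using Y by (intro one_le_power) simp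
      ultimately have "((1 + Y) ^ k - 1) * \<bar>\<psi>\<bar> \<le> ((1 + X) ^ k - 1) * \<bar>\<psi>\<bar>"
        by (intro mult_right_mono) simp_all
      moreover have "((1 + Y) ^ k - 1) * \<psi> \<le> ((1 + Y) ^ k - 1) * \<bar>\<psi>\<bar>"
        using \<open>1 \<le> (1 + Y) ^ k\<close> by (intro mult_left_mono) simp_all
      ultimately show ?thesis by linarith
    qed
    finally have err: "\<bar>label_weight D k a - \<psi>\<bar> \<le> ((1 + X) ^ k - 1) * \<bar>\<psi>\<bar>" .
    \<comment> \<open>If the main term vanished, the estimate would force the label weight to
      vanish too, and any admissible \<open>\<eta>\<close> would do.\<close>
    show ?thesis
    proof (cases "\<psi> = 0")
      case True
      then show ?thesis using err X0 by (intro exI[of _ 0]) (simp add: S)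
    next
      case False
      have "\<bar>label_weight D k a / \<psi> - 1\<bar> = \<bar>label_weight D k a - \<psi>\<bar> / \<bar>\<psi>\<bar>"
        using False by (simp add: abs_divide[symmetric] diff_divide_distrib)
      also have "\<dots> \<le> (1 + X) ^ k - 1" using err False by (simp add: divide_le_eq)
      finally show ?thesis
        using False by (intro exI[of _ "label_weight D k a / \<psi> - 1"]) (simp add: S)
    qed
  qed
  then obtain \<eta> where \<eta>: "fact n / real a ^ n * label_weight D k a = (1 + \<eta>) * S"
    "\<bar>\<eta>\<bar> \<le> (1 + X) ^ k - 1" by blast
  have e: "m - 1 = k" "n + m - 1 = n + k" "real a - real m + 1 = real a - real k" using m by simp_all
  show ?thesis
    unfolding e
  proof (intro exI conjI)
    show "separation_distance a m D = 1 - (1 + \<eta>) * (real a ^ k / (\<Prod>k=1..k. real (n + k)))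
        * (\<Sum>j=0..k. (- 1) ^ j * real (k choose j) * (1 - real j / real a) ^ (n + k))"
      unfolding m sep \<eta>(1) S_def by (simp only: mult.assoc)
    show "\<bar>\<eta>\<bar> \<le> (1 + (real n)\<^sup>2 / (3 * (real d - 2) * (real a - real k)\<^sup>2)) ^ k - 1"
      using \<eta>(2) unfolding X_def .
  qed
qed

end
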